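(* Let $(A,\mu,\triangle,\delta_1,\delta_2)$ be a covariant bialgebra and let $\alpha:A\to A$ be a morphism of covariant bialgebras. Then $(A,\alpha,\mu_\alpha,\triangle_\alpha,(\delta_1)_\alpha,(\delta_2)_\alpha)$ is a covariant Hom-bialgebra, where $\mu_\alpha=\alpha\circ\mu$, $\triangle_\alpha=\triangle\circ\alpha$, $(\delta_1)_\alpha=\delta_1\circ\alpha$ and $(\delta_2)_\alpha=\delta_2\circ\alpha$.
   Context: All vector spaces, linear maps and tensor products are over a field $\mathbb{K}$. A (multiplicative) Hom-associative algebra $(A,\alpha,\mu)$ is a vector space $A$ with a linear map $\alpha:A\to A$ and a bilinear map $\mu:A\otimes A\to A$, $a\otimes b\mapsto a\cdot b$, such that $(a\cdot b)\cdot\alpha(c)=\alpha(a)\cdot(b\cdot c)$ and $\alpha(a\cdot b)=\alpha(a)\cdot\alpha(b)$ for all $a,b,c\in A$. A (multiplicative) Hom-coassociative coalgebra $(A,\alpha,\triangle)$ is a vector space $A$ with linear maps $\alpha:A\to A$ and $\triangle:A\to A\otimes A$ such that $(\triangle\otimes\alpha)\circ\triangle=(\alpha\otimes\triangle)\circ\triangle$ and $(\alpha\otimes\alpha)\circ\triangle=\triangle\circ\alpha$. Multiplicativity is always assumed. Given a Hom-associative algebra $(A,\alpha,\mu)$, a linear map $d:A\to A\otimes A$ is a derivation on $A$ with values in the $A$-bimodule $A\otimes A$ if $\alpha^{\otimes 2}\circ d=d\circ\alpha$ and $$d\circ\mu=(\mu\otimes\alpha)\circ(\alpha\otimes d)+(\alpha\otimes\mu)\circ(d\otimes\alpha).$$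 Given two such derivations $\delta_1,\delta_2$, a linear map $D:A\to A\otimes A$ is a covariant derivation with respect to $(\delta_1,\delta_2)$ if $\alpha^{\otimes 2}\circ D=D\circ\alpha$ and $$D\circ\mu=(\mu\otimes\alpha)\circ(\alpha\otimes\delta_1)+(\alpha\otimes\mu)\circ(D\otimes\alpha),$$ $$D\circ\mu=(\mu\otimes\alpha)\circ(\alpha\otimes D)+(\alpha\otimes\mu)\circ(\delta_2\otimes\alpha).$$ A covariant Hom-bialgebra is a tuple $(A,\alpha,\mu,\triangle,\delta_1,\delta_2)$ such that $(A,\alpha,\mu)$ is a Hom-associative algebra, $(A,\alpha,\triangle)$ is a Hom-coassociative coalgebra, $\delta_1,\delta_2:A\to A\otimes A$ are derivations on $A$ with values in $A\otimes A$, and $\triangle$ is a covariant derivation with respect to $(\delta_1,\delta_2)$. A covariant bialgebra $(A,\mu,\triangle,\delta_1,\delta_2)$ is the case $\alpha=\mathrm{id}$ of this definition. A morphism of covariant bialgebras $\alpha:A\to A$ is a linear map with $\alpha\circ\mu=\mu\circ(\alpha\otimes\alpha)$, $(\alpha\otimes\alpha)\circ\triangle=\triangle\circ\alpha$ and $(\alpha\otimes\alpha)\circ\delta_i=\delta_i\circ\alpha$ for $i=1,2$. *)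

theory Defs
  imports "HOL-Algebra.Module" "HOL-Algebra.AbelCoset"
begin

section \<open>Linear maps, free modules and quotient modules\<close>

text \<open>
  A vector space over a field \<open>R\<close> is a \<^locale>\<open>module\<close> \<open>R M\<close> with \<open>R\<close> a \<^locale>\<open>field\<close>.
  Maps are total HOL functions of which only the values on the carrier matter; accordingly
  equations between maps are stated pointwise on the carrier of the source.
\<close>

definition linear_maps ::
  "('r, 's) ring_scheme \<Rightarrow> ('r, 'a, 'm) module_scheme \<Rightarrow> ('r, 'b, 'n) module_scheme \<Rightarrow> ('a \<Rightarrow> 'b) set"
  where "linear_maps R M N =
    {f \<in> carrier M \<rightarrow> carrier N.
      (\<forall>x\<in>carrier M. \<forall>y\<in>carrier M. f (x \<oplus>\<^bsub>M\<^esub> y) = f x \<oplus>\<^bsub>N\<^esub> f y) \<and>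
      (\<forall>c\<in>carrier R. \<forall>x\<in>carrier M. f (c \<odot>\<^bsub>M\<^esub> x) = c \<odot>\<^bsub>N\<^esub> f x)}"

text \<open>
  The fields \<open>mult\<close> and \<open>one\<close>, which the record type \<open>module\<close> inherits from rings, play no
  role for modules and are left \<open>undefined\<close>.
\<close>

definition free_module :: "('r, 's) ring_scheme \<Rightarrow> 'i set \<Rightarrow> ('r, 'i \<Rightarrow> 'r) module"
  where "free_module R I =
    \<lparr>carrier = {u. (\<forall>i\<in>I. u i \<in> carrier R) \<and> (\<forall>i. i \<notin> I \<longrightarrow> u i = \<zero>\<^bsub>R\<^esub>) \<and> finite {i. u i \<noteq> \<zero>\<^bsub>R\<^esub>}},
     mult = undefined, one = undefined,
     zero = (\<lambda>i. \<zero>\<^bsub>R\<^esub>),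
     add = (\<lambda>u v i. u i \<oplus>\<^bsub>R\<^esub> v i),
     smult = (\<lambda>c u i. c \<otimes>\<^bsub>R\<^esub> u i)\<rparr>"

definition free_gen :: "('r, 's) ring_scheme \<Rightarrow> 'i \<Rightarrow> 'i \<Rightarrow> 'r"
  where "free_gen R i = (\<lambda>j. if j = i then \<one>\<^bsub>R\<^esub> else \<zero>\<^bsub>R\<^esub>)"

definition submodule_generated ::
  "('r, 's) ring_scheme \<Rightarrow> ('r, 'a, 'm) module_scheme \<Rightarrow> 'a set \<Rightarrow> 'a set"
  where "submodule_generated R M S = \<Inter> {H. submodule H R M \<and> S \<subseteq> H}"

definition quotient_module :: "('r, 'a, 'm) module_scheme \<Rightarrow> 'a set \<Rightarrow> ('r, 'a set) module"
  where "quotient_module M H =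
    \<lparr>carrier = a_rcosets\<^bsub>M\<^esub> H,
     mult = undefined, one = undefined,
     zero = H,
     add = set_add M,
     smult = (\<lambda>c X. \<Union>x\<in>X. H +>\<^bsub>M\<^esub> (c \<odot>\<^bsub>M\<^esub> x))\<rparr>"


section \<open>Tensor products\<close>

text \<open>
  \<open>M \<otimes> N\<close> is the free module on \<open>carrier M \<times> carrier N\<close> modulo the submodule generated by the
  bilinearity relations.
\<close>

definition bilinearity_relations ::
  "('r, 's) ring_scheme \<Rightarrow> ('r, 'a, 'm) module_scheme \<Rightarrow> ('r, 'b, 'n) module_scheme \<Rightarrow> ('a \<times> 'b \<Rightarrow> 'r) set"
  where "bilinearity_relations R M N =
    (let F = free_module R (carrier M \<times> carrier N); g = (\<lambda>x y. free_gen R (x, y)) in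
      {g (x \<oplus>\<^bsub>M\<^esub> x') y \<ominus>\<^bsub>F\<^esub> (g x y \<oplus>\<^bsub>F\<^esub> g x' y) |x x' y.
         x \<in> carrier M \<and> x' \<in> carrier M \<and> y \<in> carrier N} \<union>
      {g x (y \<oplus>\<^bsub>N\<^esub> y') \<ominus>\<^bsub>F\<^esub> (g x y \<oplus>\<^bsub>F\<^esub> g x y') |x y y'.
         x \<in> carrier M \<and> y \<in> carrier N \<and> y' \<in> carrier N} \<union>
      {g (c \<odot>\<^bsub>M\<^esub> x) y \<ominus>\<^bsub>F\<^esub> c \<odot>\<^bsub>F\<^esub> g x y |c x y.
         c \<in> carrier R \<and> x \<in> carrier M \<and> y \<in> carrier N} \<union>
      {g x (c \<odot>\<^bsub>N\<^esub> y) \<ominus>\<^bsub>F\<^esub> c \<odot>\<^bsub>F\<^esub> g x y |c x y.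
         c \<in> carrier R \<and> x \<in> carrier M \<and> y \<in> carrier N})"

definition tensor_kernel ::
  "('r, 's) ring_scheme \<Rightarrow> ('r, 'a, 'm) module_scheme \<Rightarrow> ('r, 'b, 'n) module_scheme \<Rightarrow> ('a \<times> 'b \<Rightarrow> 'r) set"
  where "tensor_kernel R M N =
    submodule_generated R (free_module R (carrier M \<times> carrier N)) (bilinearity_relations R M N)"

definition tensor ::
  "('r, 's) ring_scheme \<Rightarrow> ('r, 'a, 'm) module_scheme \<Rightarrow> ('r, 'b, 'n) module_scheme
    \<Rightarrow> ('r, ('a \<times> 'b \<Rightarrow> 'r) set) module"
  where "tensor R M N =
    quotient_module (free_module R (carrier M \<times> carrier N)) (tensor_kernel R M N)"

definition pure_tensor ::
  "('r, 's) ring_scheme \<Rightarrow> ('r, 'a, 'm) module_scheme \<Rightarrow> ('r, 'b, 'n) module_scheme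
    \<Rightarrow> 'a \<Rightarrow> 'b \<Rightarrow> ('a \<times> 'b \<Rightarrow> 'r) set"
  where "pure_tensor R M N x y =
    tensor_kernel R M N +>\<^bsub>free_module R (carrier M \<times> carrier N)\<^esub> free_gen R (x, y)"

text \<open>
  The linear map \<open>M \<otimes> N \<rightarrow> P\<close> induced by a bilinear map \<open>\<beta>\<close>. It sends the class of a formal sum \<open>u\<close>
  of pairs \<open>(x, y)\<close> to the corresponding sum of the vectors \<open>\<beta> x y\<close> in \<open>P\<close>; this does not depend
  on the representative \<open>u\<close>, so \<^const>\<open>the_elem\<close> is applied to a singleton.
\<close>

definition tensor_lift ::
  "('r, 's) ring_scheme \<Rightarrow> ('r, 'c, 'p) module_scheme \<Rightarrow> ('a \<Rightarrow> 'b \<Rightarrow> 'c) \<Rightarrow> ('a \<times> 'b \<Rightarrow> 'r) set \<Rightarrow> 'c"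
  where "tensor_lift R P \<beta> X =
    the_elem ((\<lambda>u. \<Oplus>\<^bsub>P\<^esub>i\<in>{i. u i \<noteq> \<zero>\<^bsub>R\<^esub>}. u i \<odot>\<^bsub>P\<^esub> \<beta> (fst i) (snd i)) ` X)"

text \<open>
  \<open>tensor_map R M' N' f g\<close> is \<open>f \<otimes> g : M \<otimes> N \<rightarrow> M' \<otimes> N'\<close> for linear \<open>f : M \<rightarrow> M'\<close>, \<open>g : N \<rightarrow> N'\<close>.
\<close>

definition tensor_map ::
  "('r, 's) ring_scheme \<Rightarrow> ('r, 'c, 'm) module_scheme \<Rightarrow> ('r, 'd, 'n) module_scheme
    \<Rightarrow> ('a \<Rightarrow> 'c) \<Rightarrow> ('b \<Rightarrow> 'd) \<Rightarrow> ('a \<times> 'b \<Rightarrow> 'r) set \<Rightarrow> ('c \<times> 'd \<Rightarrow> 'r) set"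
  where "tensor_map R M' N' f g =
    tensor_lift R (tensor R M' N') (\<lambda>x y. pure_tensor R M' N' (f x) (g y))"

text \<open>The canonical isomorphisms \<open>(L \<otimes> M) \<otimes> N \<rightarrow> L \<otimes> (M \<otimes> N)\<close> and back.\<close>

definition tensor_assoc ::
  "('r, 's) ring_scheme \<Rightarrow> ('r, 'a, 'l) module_scheme \<Rightarrow> ('r, 'b, 'm) module_scheme
    \<Rightarrow> ('r, 'c, 'n) module_scheme
    \<Rightarrow> (('a \<times> 'b \<Rightarrow> 'r) set \<times> 'c \<Rightarrow> 'r) set \<Rightarrow> ('a \<times> ('b \<times> 'c \<Rightarrow> 'r) set \<Rightarrow> 'r) set"
  where "tensor_assoc R L M N =
    (let T = tensor R L (tensor R M N) in
      tensor_lift R T (\<lambda>t z.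
        tensor_lift R T (\<lambda>x y. pure_tensor R L (tensor R M N) x (pure_tensor R M N y z)) t))"

definition tensor_assoc_inv ::
  "('r, 's) ring_scheme \<Rightarrow> ('r, 'a, 'l) module_scheme \<Rightarrow> ('r, 'b, 'm) module_scheme
    \<Rightarrow> ('r, 'c, 'n) module_scheme
    \<Rightarrow> ('a \<times> ('b \<times> 'c \<Rightarrow> 'r) set \<Rightarrow> 'r) set \<Rightarrow> (('a \<times> 'b \<Rightarrow> 'r) set \<times> 'c \<Rightarrow> 'r) set"
  where "tensor_assoc_inv R L M N =
    (let T = tensor R (tensor R L M) N in
      tensor_lift R T (\<lambda>x t.
        tensor_lift R T (\<lambda>y z. pure_tensor R (tensor R L M) N (pure_tensor R L M x y) z) t))"


section \<open>Covariant Hom-bialgebras\<close>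

text \<open>
  In the following locales the triple tensor products \<open>(A \<otimes> A) \<otimes> A\<close> and \<open>A \<otimes> (A \<otimes> A)\<close>, which are
  usually identified, are kept apart, and the identification is made explicit by
  \<^const>\<open>tensor_assoc\<close> and \<^const>\<open>tensor_assoc_inv\<close>.
\<close>

locale hom_associative_algebra = R?: field R + module R A
  for R :: "('r, 's) ring_scheme" and A :: "('r, 'a, 'm) module_scheme" +
  fixes \<alpha> :: "'a \<Rightarrow> 'a" and \<mu> :: "('a \<times> 'a \<Rightarrow> 'r) set \<Rightarrow> 'a"
  assumes twist_linear: "\<alpha> \<in> linear_maps R A A"
    and mult_linear: "\<mu> \<in> linear_maps R (tensor R A A) A"
    and hom_associative:
      "\<lbrakk>a \<in> carrier A; b \<in> carrier A; c \<in> carrier A\<rbrakk> \<Longrightarrow>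
        \<mu> (pure_tensor R A A (\<mu> (pure_tensor R A A a b)) (\<alpha> c)) =
        \<mu> (pure_tensor R A A (\<alpha> a) (\<mu> (pure_tensor R A A b c)))"
    and mult_multiplicative:
      "\<lbrakk>a \<in> carrier A; b \<in> carrier A\<rbrakk> \<Longrightarrow>
        \<alpha> (\<mu> (pure_tensor R A A a b)) = \<mu> (pure_tensor R A A (\<alpha> a) (\<alpha> b))"

locale hom_coassociative_coalgebra = R?: field R + module R A
  for R :: "('r, 's) ring_scheme" and A :: "('r, 'a, 'm) module_scheme" +
  fixes \<alpha> :: "'a \<Rightarrow> 'a" and \<Delta> :: "'a \<Rightarrow> ('a \<times> 'a \<Rightarrow> 'r) set"
  assumes twist_linear: "\<alpha> \<in> linear_maps R A A"
    and comult_linear: "\<Delta> \<in> linear_maps R A (tensor R A A)"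
    and hom_coassociative:
      "a \<in> carrier A \<Longrightarrow>
        tensor_assoc R A A A (tensor_map R (tensor R A A) A \<Delta> \<alpha> (\<Delta> a)) =
        tensor_map R A (tensor R A A) \<alpha> \<Delta> (\<Delta> a)"
    and comult_multiplicative:
      "a \<in> carrier A \<Longrightarrow> tensor_map R A A \<alpha> \<alpha> (\<Delta> a) = \<Delta> (\<alpha> a)"

text \<open>
  The values at \<open>t \<in> A \<otimes> A\<close> of the two compositions \<open>(\<mu> \<otimes> \<alpha>) \<circ> (\<alpha> \<otimes> d)\<close> and
  \<open>(\<alpha> \<otimes> \<mu>) \<circ> (d \<otimes> \<alpha>)\<close>, which express the left action of \<open>a\<close> on \<open>d b\<close> and the right
  action of \<open>b\<close> on \<open>d a\<close> for \<open>t = a \<otimes> b\<close>.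
\<close>

definition left_term ::
  "('r, 's) ring_scheme \<Rightarrow> ('r, 'a, 'm) module_scheme \<Rightarrow> ('a \<Rightarrow> 'a) \<Rightarrow> (('a \<times> 'a \<Rightarrow> 'r) set \<Rightarrow> 'a)
    \<Rightarrow> ('a \<Rightarrow> ('a \<times> 'a \<Rightarrow> 'r) set) \<Rightarrow> ('a \<times> 'a \<Rightarrow> 'r) set \<Rightarrow> ('a \<times> 'a \<Rightarrow> 'r) set"
  where "left_term R A \<alpha> \<mu> d t =
    tensor_map R A A \<mu> \<alpha> (tensor_assoc_inv R A A A (tensor_map R A (tensor R A A) \<alpha> d t))"

definition right_term ::
  "('r, 's) ring_scheme \<Rightarrow> ('r, 'a, 'm) module_scheme \<Rightarrow> ('a \<Rightarrow> 'a) \<Rightarrow> (('a \<times> 'a \<Rightarrow> 'r) set \<Rightarrow> 'a)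
    \<Rightarrow> ('a \<Rightarrow> ('a \<times> 'a \<Rightarrow> 'r) set) \<Rightarrow> ('a \<times> 'a \<Rightarrow> 'r) set \<Rightarrow> ('a \<times> 'a \<Rightarrow> 'r) set"
  where "right_term R A \<alpha> \<mu> d t =
    tensor_map R A A \<alpha> \<mu> (tensor_assoc R A A A (tensor_map R (tensor R A A) A d \<alpha> t))"

locale hom_derivation = hom_associative_algebra R A \<alpha> \<mu>
  for R :: "('r, 's) ring_scheme" and A :: "('r, 'a, 'm) module_scheme" and \<alpha> \<mu> +
  fixes d :: "'a \<Rightarrow> ('a \<times> 'a \<Rightarrow> 'r) set"
  assumes deriv_linear: "d \<in> linear_maps R A (tensor R A A)"
    and deriv_twist: "a \<in> carrier A \<Longrightarrow> tensor_map R A A \<alpha> \<alpha> (d a) = d (\<alpha> a)"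
    and deriv_mult:
      "t \<in> carrier (tensor R A A) \<Longrightarrow>
        d (\<mu> t) = left_term R A \<alpha> \<mu> d t \<oplus>\<^bsub>tensor R A A\<^esub> right_term R A \<alpha> \<mu> d t"

locale hom_covariant_derivation =
  d1: hom_derivation R A \<alpha> \<mu> \<delta>\<^sub>1 + d2: hom_derivation R A \<alpha> \<mu> \<delta>\<^sub>2
  for R :: "('r, 's) ring_scheme" and A :: "('r, 'a, 'm) module_scheme" and \<alpha> \<mu> \<delta>\<^sub>1 \<delta>\<^sub>2 +
  fixes D :: "'a \<Rightarrow> ('a \<times> 'a \<Rightarrow> 'r) set"
  assumes covariant_linear: "D \<in> linear_maps R A (tensor R A A)"
    and covariant_twist: "a \<in> carrier A \<Longrightarrow> tensor_map R A A \<alpha> \<alpha> (D a) = D (\<alpha> a)"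
    and covariant_mult1:
      "t \<in> carrier (tensor R A A) \<Longrightarrow>
        D (\<mu> t) = left_term R A \<alpha> \<mu> \<delta>\<^sub>1 t \<oplus>\<^bsub>tensor R A A\<^esub> right_term R A \<alpha> \<mu> D t"
    and covariant_mult2:
      "t \<in> carrier (tensor R A A) \<Longrightarrow>
        D (\<mu> t) = left_term R A \<alpha> \<mu> D t \<oplus>\<^bsub>tensor R A A\<^esub> right_term R A \<alpha> \<mu> \<delta>\<^sub>2 t"

definition covariant_hom_bialgebra ::
  "('r, 's) ring_scheme \<Rightarrow> ('r, 'a, 'm) module_scheme \<Rightarrow> ('a \<Rightarrow> 'a) \<Rightarrow> (('a \<times> 'a \<Rightarrow> 'r) set \<Rightarrow> 'a)
    \<Rightarrow> ('a \<Rightarrow> ('a \<times> 'a \<Rightarrow> 'r) set) \<Rightarrow> ('a \<Rightarrow> ('a \<times> 'a \<Rightarrow> 'r) set) \<Rightarrow> ('a \<Rightarrow> ('a \<times> 'a \<Rightarrow> 'r) set) \<Rightarrow> bool"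
  where "covariant_hom_bialgebra R A \<alpha> \<mu> \<Delta> \<delta>\<^sub>1 \<delta>\<^sub>2 \<longleftrightarrow>
    hom_associative_algebra R A \<alpha> \<mu> \<and>
    hom_coassociative_coalgebra R A \<alpha> \<Delta> \<and>
    hom_derivation R A \<alpha> \<mu> \<delta>\<^sub>1 \<and>
    hom_derivation R A \<alpha> \<mu> \<delta>\<^sub>2 \<and>
    hom_covariant_derivation R A \<alpha> \<mu> \<delta>\<^sub>1 \<delta>\<^sub>2 \<Delta>"

definition covariant_bialgebra ::
  "('r, 's) ring_scheme \<Rightarrow> ('r, 'a, 'm) module_scheme \<Rightarrow> (('a \<times> 'a \<Rightarrow> 'r) set \<Rightarrow> 'a)
    \<Rightarrow> ('a \<Rightarrow> ('a \<times> 'a \<Rightarrow> 'r) set) \<Rightarrow> ('a \<Rightarrow> ('a \<times> 'a \<Rightarrow> 'r) set) \<Rightarrow> ('a \<Rightarrow> ('a \<times> 'a \<Rightarrow> 'r) set) \<Rightarrow> bool"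
  where "covariant_bialgebra R A \<mu> \<Delta> \<delta>\<^sub>1 \<delta>\<^sub>2 \<longleftrightarrow> covariant_hom_bialgebra R A id \<mu> \<Delta> \<delta>\<^sub>1 \<delta>\<^sub>2"

definition covariant_bialgebra_endomorphism ::
  "('r, 's) ring_scheme \<Rightarrow> ('r, 'a, 'm) module_scheme \<Rightarrow> (('a \<times> 'a \<Rightarrow> 'r) set \<Rightarrow> 'a)
    \<Rightarrow> ('a \<Rightarrow> ('a \<times> 'a \<Rightarrow> 'r) set) \<Rightarrow> ('a \<Rightarrow> ('a \<times> 'a \<Rightarrow> 'r) set) \<Rightarrow> ('a \<Rightarrow> ('a \<times> 'a \<Rightarrow> 'r) set)
    \<Rightarrow> ('a \<Rightarrow> 'a) \<Rightarrow> bool"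
  where "covariant_bialgebra_endomorphism R A \<mu> \<Delta> \<delta>\<^sub>1 \<delta>\<^sub>2 \<alpha> \<longleftrightarrow>
    \<alpha> \<in> linear_maps R A A \<and>
    (\<forall>t\<in>carrier (tensor R A A). \<alpha> (\<mu> t) = \<mu> (tensor_map R A A \<alpha> \<alpha> t)) \<and>
    (\<forall>a\<in>carrier A. tensor_map R A A \<alpha> \<alpha> (\<Delta> a) = \<Delta> (\<alpha> a)) \<and>
    (\<forall>a\<in>carrier A. tensor_map R A A \<alpha> \<alpha> (\<delta>\<^sub>1 a) = \<delta>\<^sub>1 (\<alpha> a)) \<and>
    (\<forall>a\<in>carrier A. tensor_map R A A \<alpha> \<alpha> (\<delta>\<^sub>2 a) = \<delta>\<^sub>2 (\<alpha> a))"

end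

theory Submission
  imports Defs
begin

text \<open>
  As \<open>\<alpha>\<close> commutes with the structure maps and \<open>\<otimes>\<close> is functorial, every composite in the axioms of the
  twisted structure is \<open>\<alpha> \<otimes> \<alpha>\<close> or the identity after the untwisted composite after \<open>\<alpha> \<otimes> \<alpha>\<close>:
  for instance \<open>(\<alpha>\<mu> \<otimes> \<alpha>) \<circ> (\<alpha> \<otimes> d\<alpha>) = (\<alpha> \<otimes> \<alpha>) \<circ> (\<mu> \<otimes> id) \<circ> (id \<otimes> d) \<circ> (\<alpha> \<otimes> \<alpha>)\<close>. Splitting off
  one factor on each side of the associativity isomorphism avoids its naturality; only the fact that
  it maps into the right carrier is needed.
\<close>

text \<open>Functoriality of the tensor product has to be built from the coset model: elements are
  classes of formal sums of pairs, and a map out of them is given by a sum over a representative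
  chosen through \<open>the_elem\<close>. Most of the work is therefore the universal property: a
  bilinear map kills the bilinearity relations, so its linear extension is constant on cosets and
  the lift is linear. Since maps are total functions with arbitrary values off the carriers,
  equality of lifts can only be deduced from agreement on carriers, and every composition law needs
  its argument to lie in the source carrier. This is why closure of the intermediate terms has to be
  tracked. The delicate closure fact concerns the associativity maps, which are lifts nested inside
  lifts. The outer lift makes sense only if the inner one depends linearly on the remaining
  variable, so lifts have to be studied as functions of the bilinear map as well.\<close>

lemma linear_mapsI:
  assumes "\<And>x. x \<in> carrier M \<Longrightarrow> f x \<in> carrier N"
    and "\<And>x y. \<lbrakk>x \<in> carrier M; y \<in> carrier M\<rbrakk> \<Longrightarrow> f (x \<oplus>\<^bsub>M\<^esub> y) = f x \<oplus>\<^bsub>N\<^esub> f y"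
    and "\<And>c x. \<lbrakk>c \<in> carrier R; x \<in> carrier M\<rbrakk> \<Longrightarrow> f (c \<odot>\<^bsub>M\<^esub> x) = c \<odot>\<^bsub>N\<^esub> f x"
  shows "f \<in> linear_maps R M N"
  using assms by (auto simp: linear_maps_def)

lemma linear_mapsD:
  assumes "f \<in> linear_maps R M N"
  shows linear_maps_closed: "x \<in> carrier M \<Longrightarrow> f x \<in> carrier N"
    and linear_maps_add: "\<lbrakk>x \<in> carrier M; y \<in> carrier M\<rbrakk> \<Longrightarrow> f (x \<oplus>\<^bsub>M\<^esub> y) = f x \<oplus>\<^bsub>N\<^esub> f y"
    and linear_maps_smult: "\<lbrakk>c \<in> carrier R; x \<in> carrier M\<rbrakk> \<Longrightarrow> f (c \<odot>\<^bsub>M\<^esub> x) = c \<odot>\<^bsub>N\<^esub> f x"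
  using assms by (auto simp: linear_maps_def)

lemma linear_maps_id: "id \<in> linear_maps R M M"
  by (rule linear_mapsI) auto

lemma linear_maps_comp:
  assumes "f \<in> linear_maps R M N" "g \<in> linear_maps R N P"
  shows "g \<circ> f \<in> linear_maps R M P"
  using linear_mapsD[OF assms(1)] linear_mapsD[OF assms(2)] by (intro linear_mapsI) simp_all

lemma linear_maps_pointwise_add:
  assumes P: "module R P" and f: "f \<in> linear_maps R M P" and g: "g \<in> linear_maps R M P"
  shows "(\<lambda>x. f x \<oplus>\<^bsub>P\<^esub> g x) \<in> linear_maps R M P"
proof -
  interpret P: module R P by (rule P)
  show ?thesis
    using linear_mapsD[OF f] linear_mapsD[OF g]
    by (intro linear_mapsI) (simp_all add: P.M.a_ac P.smult_r_distr)
qed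

lemma linear_maps_zero:
  assumes "module R M" "module R N" "f \<in> linear_maps R M N"
  shows "f \<zero>\<^bsub>M\<^esub> = \<zero>\<^bsub>N\<^esub>"
proof -
  interpret M: module R M by fact
  interpret N: module R N by fact
  \<comment> \<open>Writing zero as the zero scalar times zero lets homogeneity alone give the
    claim.\<close>
  have "f (\<zero>\<^bsub>R\<^esub> \<odot>\<^bsub>M\<^esub> \<zero>\<^bsub>M\<^esub>) = \<zero>\<^bsub>R\<^esub> \<odot>\<^bsub>N\<^esub> f \<zero>\<^bsub>M\<^esub>"
    by (rule linear_maps_smult[OF assms(3)]) simp_all
  then show ?thesis
    using linear_maps_closed[OF assms(3)] by simp
qed

lemma linear_maps_finsum:
  assumes "module R M" "module R N" "f \<in> linear_maps R M N"
    and "finite S" "b \<in> S \<rightarrow> carrier M"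
  shows "f (\<Oplus>\<^bsub>M\<^esub>i\<in>S. b i) = (\<Oplus>\<^bsub>N\<^esub>i\<in>S. f (b i))"
proof -
  interpret M: module R M by fact
  interpret N: module R N by fact
  note f = linear_mapsD[OF assms(3)]
  show ?thesis
    using \<open>finite S\<close> \<open>b \<in> S \<rightarrow> carrier M\<close>
  proof (induction S)
    case empty
    then show ?case using linear_maps_zero[OF assms(1-3)] by simp
  next
    case (insert i S)
    have S: "b \<in> S \<rightarrow> carrier M" "b i \<in> carrier M" using insert.prems by auto
    have fS: "(\<lambda>i. f (b i)) \<in> S \<rightarrow> carrier N" "f (b i) \<in> carrier N"
      using S by (auto intro: f(1))
    have "f (\<Oplus>\<^bsub>M\<^esub>i\<in>insert i S. b i) = f (b i) \<oplus>\<^bsub>N\<^esub> f (\<Oplus>\<^bsub>M\<^esub>i\<in>S. b i)"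
      unfolding M.M.finsum_insert[OF insert.hyps S] by (rule f(2)[OF S(2) M.M.finsum_closed[OF S(1)]])
    also have "\<dots> = (\<Oplus>\<^bsub>N\<^esub>i\<in>insert i S. f (b i))"
      unfolding N.M.finsum_insert[OF insert.hyps fS] insert.IH[OF S(1)] ..
    finally show ?case .
  qed
qed

lemma linear_maps_minus:
  assumes "module R M" "module R N" "f \<in> linear_maps R M N" "x \<in> carrier M"
  shows "f (\<ominus>\<^bsub>M\<^esub> x) = \<ominus>\<^bsub>N\<^esub> f x"
proof -
  interpret M: module R M by fact
  interpret N: module R N by fact
  have "f (\<ominus>\<^bsub>M\<^esub> x) = f ((\<ominus>\<^bsub>R\<^esub> \<one>\<^bsub>R\<^esub>) \<odot>\<^bsub>M\<^esub> x)"
    using assms(4) by (simp add: M.smult_l_minus)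
  also have "\<dots> = (\<ominus>\<^bsub>R\<^esub> \<one>\<^bsub>R\<^esub>) \<odot>\<^bsub>N\<^esub> f x"
    using assms(4) by (intro linear_maps_smult[OF assms(3)]) auto
  also have "\<dots> = \<ominus>\<^bsub>N\<^esub> f x"
    using linear_maps_closed[OF assms(3,4)] by (simp add: N.smult_l_minus)
  finally show ?thesis .
qed

text \<open>Makes it possible to show that a linear map vanishes on a generated submodule by
  checking the generators only.\<close>

lemma kernel_submodule:
  assumes "module R M" "module R N" "f \<in> linear_maps R M N"
  shows "submodule {x \<in> carrier M. f x = \<zero>\<^bsub>N\<^esub>} R M"
proof -
  interpret M: module R M by fact
  interpret N: module R N by fact
  note f = linear_mapsD[OF assms(3)]
  show ?thesis
    by (rule M.submoduleI) (use f linear_maps_minus[OF assms] linear_maps_zero[OF assms] in auto)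
qed


section \<open>Free modules\<close>

lemma free_module_simps:
  "carrier (free_module R I) = {u. (\<forall>i\<in>I. u i \<in> carrier R) \<and> (\<forall>i. i \<notin> I \<longrightarrow> u i = \<zero>\<^bsub>R\<^esub>) \<and> finite {i. u i \<noteq> \<zero>\<^bsub>R\<^esub>}}"
  "zero (free_module R I) = (\<lambda>i. \<zero>\<^bsub>R\<^esub>)"
  "u \<oplus>\<^bsub>free_module R I\<^esub> v = (\<lambda>i. u i \<oplus>\<^bsub>R\<^esub> v i)"
  "c \<odot>\<^bsub>free_module R I\<^esub> u = (\<lambda>i. c \<otimes>\<^bsub>R\<^esub> u i)"
  by (simp_all add: free_module_def)

text \<open>Outside \<open>I\<close> the value is zero, which is also in the ring, so coefficients
  can be used without tracking their index.\<close>

lemma (in cring) free_module_value_closed: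
  "u \<in> carrier (free_module R I) \<Longrightarrow> u i \<in> carrier R"
  by (cases "i \<in> I") (auto simp: free_module_simps)

lemma (in cring) free_module_module: "module R (free_module R I)"
proof -
  note val = free_module_value_closed
  have add: "u \<oplus>\<^bsub>free_module R I\<^esub> v \<in> carrier (free_module R I)"
    if "u \<in> carrier (free_module R I)" "v \<in> carrier (free_module R I)" for u v
  proof -
    \<comment> \<open>The ring laws hold pointwise; finiteness of the support is the only part of
      closure that needs an argument, here via the union of two supports.\<close>
    have "finite {i. u i \<oplus> v i \<noteq> \<zero>}"
      by (rule finite_subset[of _ "{i. u i \<noteq> \<zero>} \<union> {i. v i \<noteq> \<zero>}"]) (use that in \<open>auto simp: free_module_simps\<close>)
    then show ?thesis
      using that by (auto simp: free_module_simps)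
  qed
  have smult: "c \<odot>\<^bsub>free_module R I\<^esub> u \<in> carrier (free_module R I)"
    if "c \<in> carrier R" "u \<in> carrier (free_module R I)" for c u
  proof -
    have "finite {i. c \<otimes> u i \<noteq> \<zero>}"
      by (rule finite_subset[of _ "{i. u i \<noteq> \<zero>}"]) (use that in \<open>auto simp: free_module_simps\<close>)
    then show ?thesis
      using that by (auto simp: free_module_simps)
  qed
  have "abelian_group (free_module R I)"
  proof (rule abelian_groupI)
    fix u assume u: "u \<in> carrier (free_module R I)"
    \<comment> \<open>Taking the inverse of \<open>u\<close> to be its multiple by minus one makes
      its membership a case of closure under scaling.\<close>
    have "(\<ominus> \<one>) \<odot>\<^bsub>free_module R I\<^esub> u \<oplus>\<^bsub>free_module R I\<^esub> u = \<zero>\<^bsub>free_module R I\<^esub>"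
      using val[OF u] by (simp add: free_module_simps l_minus l_neg)
    then show "\<exists>v\<in>carrier (free_module R I). v \<oplus>\<^bsub>free_module R I\<^esub> u = \<zero>\<^bsub>free_module R I\<^esub>"
      using smult[OF _ u, of "\<ominus> \<one>"] by auto
  next
    fix u v assume "u \<in> carrier (free_module R I)" "v \<in> carrier (free_module R I)"
    then show "u \<oplus>\<^bsub>free_module R I\<^esub> v = v \<oplus>\<^bsub>free_module R I\<^esub> u"
      unfolding free_module_simps(3) by (intro ext a_comm val)
  next
    fix u v w assume "u \<in> carrier (free_module R I)" "v \<in> carrier (free_module R I)"
      "w \<in> carrier (free_module R I)"
    then show "u \<oplus>\<^bsub>free_module R I\<^esub> v \<oplus>\<^bsub>free_module R I\<^esub> w = u \<oplus>\<^bsub>free_module R I\<^esub> (v \<oplus>\<^bsub>free_module R I\<^esub> w)"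
      unfolding free_module_simps(3) by (intro ext a_assoc val)
  next
    fix u assume "u \<in> carrier (free_module R I)"
    then show "\<zero>\<^bsub>free_module R I\<^esub> \<oplus>\<^bsub>free_module R I\<^esub> u = u"
      using val[of u I] by (simp add: free_module_simps(2,3))
  next
    show "\<zero>\<^bsub>free_module R I\<^esub> \<in> carrier (free_module R I)"
      by (simp add: free_module_simps)
  qed (use add in auto)
  moreover note smult
  moreover have "(a \<oplus> b) \<odot>\<^bsub>free_module R I\<^esub> u
      = a \<odot>\<^bsub>free_module R I\<^esub> u \<oplus>\<^bsub>free_module R I\<^esub> b \<odot>\<^bsub>free_module R I\<^esub> u"
    if "a \<in> carrier R" "b \<in> carrier R" "u \<in> carrier (free_module R I)" for a b u
    using that val[of u I] by (simp add: free_module_simps(3,4) l_distr)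
  moreover have "a \<odot>\<^bsub>free_module R I\<^esub> (u \<oplus>\<^bsub>free_module R I\<^esub> v)
      = a \<odot>\<^bsub>free_module R I\<^esub> u \<oplus>\<^bsub>free_module R I\<^esub> a \<odot>\<^bsub>free_module R I\<^esub> v"
    if "a \<in> carrier R" "u \<in> carrier (free_module R I)" "v \<in> carrier (free_module R I)" for a u v
    using that val[of u I] val[of v I] by (simp add: free_module_simps(3,4) r_distr)
  moreover have "(a \<otimes> b) \<odot>\<^bsub>free_module R I\<^esub> u
      = a \<odot>\<^bsub>free_module R I\<^esub> (b \<odot>\<^bsub>free_module R I\<^esub> u)"
    if "a \<in> carrier R" "b \<in> carrier R" "u \<in> carrier (free_module R I)" for a b u
    using that val[of u I] by (simp add: free_module_simps(4) m_assoc)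
  moreover have "\<one> \<odot>\<^bsub>free_module R I\<^esub> u = u" if "u \<in> carrier (free_module R I)" for u
    using that val[of u I] by (simp add: free_module_simps(4))
  ultimately show ?thesis
    by (intro moduleI[OF is_cring])
qed

lemma (in cring) free_gen_closed: "i \<in> I \<Longrightarrow> free_gen R i \<in> carrier (free_module R I)"
  by (auto simp: free_module_simps free_gen_def)

text \<open>The linear extension of \<open>b\<close> from the generators to the free module; it is
  the sum inside \<open>tensor_lift\<close> before passing to cosets. Summing over the support keeps
  the index set finite when \<open>I\<close> is infinite.\<close>

definition free_lift ::
  "('r, 's) ring_scheme \<Rightarrow> ('r, 'b, 'p) module_scheme \<Rightarrow> ('i \<Rightarrow> 'b) \<Rightarrow> ('i \<Rightarrow> 'r) \<Rightarrow> 'b"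
  where "free_lift R P b u = (\<Oplus>\<^bsub>P\<^esub>i\<in>{i. u i \<noteq> \<zero>\<^bsub>R\<^esub>}. u i \<odot>\<^bsub>P\<^esub> b i)"

context module
begin

text \<open>Zero coefficients contribute nothing. Enlarging the index set is needed because the
  supports of \<open>u\<close>, \<open>v\<close>, their sum and their multiples differ.\<close>

lemma free_lift_superset:
  assumes "u \<in> carrier (free_module R I)" "b \<in> I \<rightarrow> carrier M"
    and "finite S" "{i. u i \<noteq> \<zero>} \<subseteq> S" "S \<subseteq> I"
  shows "free_lift R M b u = (\<Oplus>\<^bsub>M\<^esub>i\<in>S. u i \<odot>\<^bsub>M\<^esub> b i)"
  unfolding free_lift_def
  by (rule M.add.finprod_mono_neutral_cong_left)
    (use assms R.free_module_value_closed[OF assms(1)] in \<open>auto simp: Pi_iff subset_eq\<close>)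

text \<open>The support of \<open>u\<close> lies in \<open>I\<close>, so values of \<open>b\<close>
  elsewhere never enter the sum.\<close>

lemma free_lift_cong:
  assumes "u \<in> carrier (free_module R I)" "b \<in> I \<rightarrow> carrier M"
    and "\<And>i. i \<in> I \<Longrightarrow> b' i = b i"
  shows "free_lift R M b' u = free_lift R M b u"
proof -
  have "{i. u i \<noteq> \<zero>} \<subseteq> I" using assms(1) by (auto simp: free_module_simps)
  then show ?thesis
    unfolding free_lift_def
    by (intro M.add.finprod_cong')
      (use assms R.free_module_value_closed[OF assms(1)] in \<open>auto simp: Pi_iff subset_eq\<close>)
qed

lemma free_lift_linear:
  assumes b: "b \<in> I \<rightarrow> carrier M"
  shows "free_lift R M b \<in> linear_maps R (free_module R I) M"
proof (rule linear_mapsI)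
  fix u assume u: "u \<in> carrier (free_module R I)"
  have uI: "{i. u i \<noteq> \<zero>} \<subseteq> I" and fin_u: "finite {i. u i \<noteq> \<zero>}"
    using u by (auto simp: free_module_simps)
  note uc = R.free_module_value_closed[OF u]
  have ub: "(\<lambda>i. u i \<odot>\<^bsub>M\<^esub> b i) \<in> S \<rightarrow> carrier M" if "S \<subseteq> I" for S
    using uc b that by (auto simp: Pi_iff subset_eq)
  show "free_lift R M b u \<in> carrier M"
    unfolding free_lift_def by (rule M.finsum_closed) (rule ub[OF uI])
  {
    fix v assume v: "v \<in> carrier (free_module R I)"
    have vI: "{i. v i \<noteq> \<zero>} \<subseteq> I" and fin_v: "finite {i. v i \<noteq> \<zero>}"
      using v by (auto simp: free_module_simps)
    note vc = R.free_module_value_closed[OF v]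
    \<comment> \<open>A common index set for \<open>u\<close>, \<open>v\<close> and their sum, whose
      own support may shrink by cancellation.\<close>
    let ?S = "{i. u i \<noteq> \<zero>} \<union> {i. v i \<noteq> \<zero>}"
    have S: "finite ?S" "?S \<subseteq> I" using uI vI fin_u fin_v by auto
    have vb: "(\<lambda>i. v i \<odot>\<^bsub>M\<^esub> b i) \<in> ?S \<rightarrow> carrier M"
      using vc b S(2) by (auto simp: Pi_iff subset_eq)
    interpret F: module R "free_module R I" by (rule R.free_module_module)
    have uv: "u \<oplus>\<^bsub>free_module R I\<^esub> v \<in> carrier (free_module R I)"
      using u v by simp
    have "free_lift R M b (u \<oplus>\<^bsub>free_module R I\<^esub> v) = (\<Oplus>\<^bsub>M\<^esub>i\<in>?S. (u i \<oplus> v i) \<odot>\<^bsub>M\<^esub> b i)"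
      by (subst free_lift_superset[OF uv b S(1) _ S(2)]) (auto simp: free_module_simps)
    also have "\<dots> = (\<Oplus>\<^bsub>M\<^esub>i\<in>?S. u i \<odot>\<^bsub>M\<^esub> b i \<oplus>\<^bsub>M\<^esub> v i \<odot>\<^bsub>M\<^esub> b i)"
      using uc vc b S(2) by (intro M.add.finprod_cong') (auto simp: smult_l_distr Pi_iff subset_eq)
    also have "\<dots> = (\<Oplus>\<^bsub>M\<^esub>i\<in>?S. u i \<odot>\<^bsub>M\<^esub> b i) \<oplus>\<^bsub>M\<^esub> (\<Oplus>\<^bsub>M\<^esub>i\<in>?S. v i \<odot>\<^bsub>M\<^esub> b i)"
      by (rule M.finsum_addf[OF ub[OF S(2)] vb])
    also have "\<dots> = free_lift R M b u \<oplus>\<^bsub>M\<^esub> free_lift R M b v"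
      using free_lift_superset[OF u b S(1) _ S(2)] free_lift_superset[OF v b S(1) _ S(2)] by auto
    finally show "free_lift R M b (u \<oplus>\<^bsub>free_module R I\<^esub> v) = free_lift R M b u \<oplus>\<^bsub>M\<^esub> free_lift R M b v" .
  }
  fix c assume c: "c \<in> carrier R"
  interpret F: module R "free_module R I" by (rule R.free_module_module)
  have cu: "c \<odot>\<^bsub>free_module R I\<^esub> u \<in> carrier (free_module R I)"
    using u c by simp
  \<comment> \<open>Scaling by \<open>c\<close> may kill coefficients, so the sum is taken over the
    support of \<open>u\<close>, which contains that of the multiple.\<close>
  have "free_lift R M b (c \<odot>\<^bsub>free_module R I\<^esub> u) = (\<Oplus>\<^bsub>M\<^esub>i\<in>{i. u i \<noteq> \<zero>}. (c \<otimes> u i) \<odot>\<^bsub>M\<^esub> b i)"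
    by (subst free_lift_superset[OF cu b fin_u _ uI]) (use c in \<open>auto simp: free_module_simps\<close>)
  also have "\<dots> = (\<Oplus>\<^bsub>M\<^esub>i\<in>{i. u i \<noteq> \<zero>}. c \<odot>\<^bsub>M\<^esub> (u i \<odot>\<^bsub>M\<^esub> b i))"
    using uc c b uI by (intro M.add.finprod_cong') (auto simp: smult_assoc1 Pi_iff subset_eq)
  also have "\<dots> = c \<odot>\<^bsub>M\<^esub> free_lift R M b u"
    unfolding free_lift_def using finsum_smult_ldistr[OF fin_u c ub[OF uI]] by simp
  finally show "free_lift R M b (c \<odot>\<^bsub>free_module R I\<^esub> u) = c \<odot>\<^bsub>M\<^esub> free_lift R M b u" .
qed

lemma free_lift_gen:
  assumes "b \<in> I \<rightarrow> carrier M" "i \<in> I"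
  shows "free_lift R M b (free_gen R i) = b i"
proof -
  have bi: "b i \<in> carrier M" using assms by auto
  \<comment> \<open>The sum runs over \<open>{i}\<close> and not over the support, which would be
    empty if one equals zero in the ring.\<close>
  have "free_lift R M b (free_gen R i) = (\<Oplus>\<^bsub>M\<^esub>j\<in>{i}. free_gen R i j \<odot>\<^bsub>M\<^esub> b j)"
    by (rule free_lift_superset[OF R.free_gen_closed[OF assms(2)] assms(1)])
      (use assms in \<open>auto simp: free_gen_def\<close>)
  also have "\<dots> = b i"
    using bi by (simp add: free_gen_def)
  finally show ?thesis .
qed

text \<open>Additivity in the family \<open>b\<close>, with \<open>u\<close> fixed. It becomes
  additivity of lifts in the bilinear map, needed for nested lifts.\<close>

lemma free_lift_add:
  assumes u: "u \<in> carrier (free_module R I)" and b: "b \<in> I \<rightarrow> carrier M" "b' \<in> I \<rightarrow> carrier M"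
  shows "free_lift R M (\<lambda>i. b i \<oplus>\<^bsub>M\<^esub> b' i) u = free_lift R M b u \<oplus>\<^bsub>M\<^esub> free_lift R M b' u"
proof -
  have uI: "{i. u i \<noteq> \<zero>} \<subseteq> I" using u by (auto simp: free_module_simps)
  note uc = R.free_module_value_closed[OF u]
  have "free_lift R M (\<lambda>i. b i \<oplus>\<^bsub>M\<^esub> b' i) u
      = (\<Oplus>\<^bsub>M\<^esub>i\<in>{i. u i \<noteq> \<zero>}. u i \<odot>\<^bsub>M\<^esub> b i \<oplus>\<^bsub>M\<^esub> u i \<odot>\<^bsub>M\<^esub> b' i)"
    unfolding free_lift_def
    using uc uI b by (intro M.add.finprod_cong') (auto simp: smult_r_distr Pi_iff subset_eq)
  also have "\<dots> = free_lift R M b u \<oplus>\<^bsub>M\<^esub> free_lift R M b' u"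
    unfolding free_lift_def using uc uI b by (intro M.finsum_addf) (auto simp: Pi_iff subset_eq)
  finally show ?thesis .
qed

end

lemma linear_free_lift:
  assumes "module R P" "module R Q" "f \<in> linear_maps R P Q"
    and "u \<in> carrier (free_module R I)" "b \<in> I \<rightarrow> carrier P"
  shows "f (free_lift R P b u) = free_lift R Q (\<lambda>i. f (b i)) u"
proof -
  interpret P: module R P by fact
  interpret Q: module R Q by fact
  have uI: "{i. u i \<noteq> \<zero>\<^bsub>R\<^esub>} \<subseteq> I" and fin: "finite {i. u i \<noteq> \<zero>\<^bsub>R\<^esub>}"
    using assms(4) by (auto simp: free_module_simps)
  note uc = P.R.free_module_value_closed[OF assms(4)]
  note f = linear_mapsD[OF assms(3)]
  have b: "b i \<in> carrier P" if "u i \<noteq> \<zero>\<^bsub>R\<^esub>" for i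
    using that uI assms(5) by blast
  have "f (free_lift R P b u) = (\<Oplus>\<^bsub>Q\<^esub>i\<in>{i. u i \<noteq> \<zero>\<^bsub>R\<^esub>}. f (u i \<odot>\<^bsub>P\<^esub> b i))"
    unfolding free_lift_def
    by (rule linear_maps_finsum[OF assms(1-3) fin]) (simp add: uc b)
  also have "\<dots> = free_lift R Q (\<lambda>i. f (b i)) u"
    unfolding free_lift_def
    by (intro Q.M.add.finprod_cong') (simp_all add: f uc b)
  finally show ?thesis .
qed


section \<open>Quotient modules\<close>

context module
begin

lemma submodule_generated_incl: "S \<subseteq> submodule_generated R M S"
  by (auto simp: submodule_generated_def)

lemma submodule_generated_minimal:
  "\<lbrakk>submodule H R M; S \<subseteq> H\<rbrakk> \<Longrightarrow> submodule_generated R M S \<subseteq> H"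
  by (auto simp: submodule_generated_def)

lemma submodule_generated_submodule:
  assumes "S \<subseteq> carrier M"
  shows "submodule (submodule_generated R M S) R M"
proof (rule submoduleI)
  let ?G = "submodule_generated R M S"
  \<comment> \<open>Membership in the intersection is tested in one submodule \<open>H\<close> at a
    time, with all of \<open>?G\<close> already known to lie in \<open>H\<close>; each closure
    property is then that of \<open>H\<close>.\<close>
  have mem: "x \<in> ?G" if "\<And>H. \<lbrakk>submodule H R M; ?G \<subseteq> H\<rbrakk> \<Longrightarrow> x \<in> H" for x
    unfolding submodule_generated_def using that[OF _ submodule_generated_minimal] by blast
  show "?G \<subseteq> carrier M"
    by (rule submodule_generated_minimal[OF carrier_is_submodule assms])
  show "\<zero>\<^bsub>M\<^esub> \<in> ?G"
    by (rule mem) (drule submodule.axioms(1)[THEN subgroup.one_closed], simp)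
  show "\<ominus>\<^bsub>M\<^esub> x \<in> ?G" if "x \<in> ?G" for x
    by (rule mem, rule submoduleE(3)) (use that in auto)
  show "x \<oplus>\<^bsub>M\<^esub> y \<in> ?G" if "x \<in> ?G" "y \<in> ?G" for x y
    by (rule mem, rule submoduleE(5)) (use that in auto)
  show "c \<odot>\<^bsub>M\<^esub> x \<in> ?G" if "c \<in> carrier R" "x \<in> ?G" for c x
    by (rule mem, rule submoduleE(4)) (use that in auto)
qed

text \<open>The bridge to the coset theory of abelian groups, from which representatives and sums of
  cosets are handled.\<close>

lemma submodule_abelian_subgroup:
  "submodule H R M \<Longrightarrow> abelian_subgroup H M"
  using abelian_subgroupI3 M.abelian_group_axioms
  by (auto simp: additive_subgroup_def dest: submodule.axioms(1))

lemma quotient_module_simps: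
  assumes "submodule H R M"
  shows quotient_module_carrier: "carrier (quotient_module M H) = (\<lambda>x. H +>\<^bsub>M\<^esub> x) ` carrier M"
    and quotient_module_add: "\<lbrakk>x \<in> carrier M; y \<in> carrier M\<rbrakk> \<Longrightarrow>
      (H +>\<^bsub>M\<^esub> x) \<oplus>\<^bsub>quotient_module M H\<^esub> (H +>\<^bsub>M\<^esub> y) = H +>\<^bsub>M\<^esub> (x \<oplus>\<^bsub>M\<^esub> y)"
    and quotient_module_smult: "\<lbrakk>c \<in> carrier R; x \<in> carrier M\<rbrakk> \<Longrightarrow>
      c \<odot>\<^bsub>quotient_module M H\<^esub> (H +>\<^bsub>M\<^esub> x) = H +>\<^bsub>M\<^esub> (c \<odot>\<^bsub>M\<^esub> x)"
    and quotient_module_zero: "\<zero>\<^bsub>quotient_module M H\<^esub> = H +>\<^bsub>M\<^esub> \<zero>\<^bsub>M\<^esub>"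
proof -
  interpret H: abelian_subgroup H M by (rule submodule_abelian_subgroup) fact
  show "carrier (quotient_module M H) = (\<lambda>x. H +>\<^bsub>M\<^esub> x) ` carrier M"
    by (auto simp: quotient_module_def A_RCOSETS_def')
  show "\<zero>\<^bsub>quotient_module M H\<^esub> = H +>\<^bsub>M\<^esub> \<zero>\<^bsub>M\<^esub>"
    using H.a_subset by (simp add: quotient_module_def)
  show "(H +>\<^bsub>M\<^esub> x) \<oplus>\<^bsub>quotient_module M H\<^esub> (H +>\<^bsub>M\<^esub> y) = H +>\<^bsub>M\<^esub> (x \<oplus>\<^bsub>M\<^esub> y)"
    if "x \<in> carrier M" "y \<in> carrier M"
    using that by (simp add: quotient_module_def H.a_rcos_sum)
  assume c: "c \<in> carrier R" and x: "x \<in> carrier M"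
  \<comment> \<open>The scalar multiple of a coset is defined as a union over all representatives.
    Two of them differ by an element of \<open>H\<close>, and \<open>H\<close> is stable under
    \<open>c\<close>, so all members of the union coincide; as the coset is nonempty, the union is
    their common value.\<close>
  have "H +>\<^bsub>M\<^esub> (c \<odot>\<^bsub>M\<^esub> y) = H +>\<^bsub>M\<^esub> (c \<odot>\<^bsub>M\<^esub> x)" if y: "y \<in> H +>\<^bsub>M\<^esub> x" for y
  proof -
    obtain h where h: "h \<in> H" "y = h \<oplus>\<^bsub>M\<^esub> x"
      using y unfolding a_r_coset_def' by blast
    have hM: "h \<in> carrier M" using h(1) by (rule H.a_Hcarr)
    have "c \<odot>\<^bsub>M\<^esub> y = c \<odot>\<^bsub>M\<^esub> h \<oplus>\<^bsub>M\<^esub> c \<odot>\<^bsub>M\<^esub> x"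
      unfolding h(2) by (rule smult_r_distr[OF c hM x])
    moreover have "c \<odot>\<^bsub>M\<^esub> h \<in> H"
      using submoduleE(4)[OF assms c h(1)] .
    ultimately have "c \<odot>\<^bsub>M\<^esub> y \<in> H +>\<^bsub>M\<^esub> (c \<odot>\<^bsub>M\<^esub> x)"
      unfolding a_r_coset_def' by blast
    then show ?thesis
      by (rule M.a_repr_independence[OF _ smult_closed[OF c x] H.a_subgroup, symmetric])
  qed
  moreover have "H +>\<^bsub>M\<^esub> x \<noteq> {}"
    using H.a_rcos_self[OF x] by blast
  ultimately have "(\<Union>y\<in>H +>\<^bsub>M\<^esub> x. H +>\<^bsub>M\<^esub> (c \<odot>\<^bsub>M\<^esub> y)) = H +>\<^bsub>M\<^esub> (c \<odot>\<^bsub>M\<^esub> x)"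
    by (rule SUP_eq_const[rotated])
  then show "c \<odot>\<^bsub>quotient_module M H\<^esub> (H +>\<^bsub>M\<^esub> x) = H +>\<^bsub>M\<^esub> (c \<odot>\<^bsub>M\<^esub> x)"
    by (simp add: quotient_module_def)
qed

lemma quotient_module_module:
  assumes "submodule H R M"
  shows "module R (quotient_module M H)"
proof -
  note Q = quotient_module_simps[OF assms]
  have "abelian_group (quotient_module M H)"
  proof (rule abelian_groupI)
    fix X assume "X \<in> carrier (quotient_module M H)"
    then obtain x where x: "x \<in> carrier M" "X = H +>\<^bsub>M\<^esub> x" by (auto simp: Q(1))
    have "(H +>\<^bsub>M\<^esub> (\<ominus>\<^bsub>M\<^esub> x)) \<oplus>\<^bsub>quotient_module M H\<^esub> X = \<zero>\<^bsub>quotient_module M H\<^esub>"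
      using x by (simp add: Q M.l_neg)
    then show "\<exists>Y\<in>carrier (quotient_module M H). Y \<oplus>\<^bsub>quotient_module M H\<^esub> X = \<zero>\<^bsub>quotient_module M H\<^esub>"
      using x by (auto simp: Q(1))
  next
    fix X Y Z assume "X \<in> carrier (quotient_module M H)" "Y \<in> carrier (quotient_module M H)"
      "Z \<in> carrier (quotient_module M H)"
    then show "X \<oplus>\<^bsub>quotient_module M H\<^esub> Y \<oplus>\<^bsub>quotient_module M H\<^esub> Z
        = X \<oplus>\<^bsub>quotient_module M H\<^esub> (Y \<oplus>\<^bsub>quotient_module M H\<^esub> Z)"
      unfolding Q(1) by (elim imageE) (simp add: Q(2) M.a_assoc)
  next
    fix X Y assume "X \<in> carrier (quotient_module M H)" "Y \<in> carrier (quotient_module M H)"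
    then show "X \<oplus>\<^bsub>quotient_module M H\<^esub> Y = Y \<oplus>\<^bsub>quotient_module M H\<^esub> X"
      and "X \<oplus>\<^bsub>quotient_module M H\<^esub> Y \<in> carrier (quotient_module M H)"
      unfolding Q(1) by (elim imageE, simp add: Q(2) M.a_comm)+
  next
    fix X assume "X \<in> carrier (quotient_module M H)"
    then show "\<zero>\<^bsub>quotient_module M H\<^esub> \<oplus>\<^bsub>quotient_module M H\<^esub> X = X"
      unfolding Q(1) by (elim imageE) (simp add: Q(2,4))
  qed (simp add: Q(1,4))
  then show ?thesis
  proof (rule moduleI[OF R.is_cring])
    fix a b X assume "a \<in> carrier R" "b \<in> carrier R" "X \<in> carrier (quotient_module M H)"
    then show "(a \<oplus> b) \<odot>\<^bsub>quotient_module M H\<^esub> X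
        = a \<odot>\<^bsub>quotient_module M H\<^esub> X \<oplus>\<^bsub>quotient_module M H\<^esub> b \<odot>\<^bsub>quotient_module M H\<^esub> X"
      and "(a \<otimes> b) \<odot>\<^bsub>quotient_module M H\<^esub> X
        = a \<odot>\<^bsub>quotient_module M H\<^esub> (b \<odot>\<^bsub>quotient_module M H\<^esub> X)"
      and "a \<odot>\<^bsub>quotient_module M H\<^esub> X \<in> carrier (quotient_module M H)"
      unfolding Q(1) by (elim imageE, simp add: Q(2,3) smult_l_distr smult_assoc1)+
  next
    fix a X Y assume "a \<in> carrier R" "X \<in> carrier (quotient_module M H)"
      "Y \<in> carrier (quotient_module M H)"
    then show "a \<odot>\<^bsub>quotient_module M H\<^esub> (X \<oplus>\<^bsub>quotient_module M H\<^esub> Y)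
        = a \<odot>\<^bsub>quotient_module M H\<^esub> X \<oplus>\<^bsub>quotient_module M H\<^esub> a \<odot>\<^bsub>quotient_module M H\<^esub> Y"
      unfolding Q(1) by (elim imageE) (simp add: Q(2,3) smult_r_distr)
  next
    fix X assume "X \<in> carrier (quotient_module M H)"
    then show "\<one> \<odot>\<^bsub>quotient_module M H\<^esub> X = X"
      unfolding Q(1) by (elim imageE) (simp add: Q(3))
  qed
qed

end


section \<open>Universal property of tensor products\<close>

definition bilinear_maps ::
  "('r, 's) ring_scheme \<Rightarrow> ('r, 'a, 'm) module_scheme \<Rightarrow> ('r, 'b, 'n) module_scheme
    \<Rightarrow> ('r, 'c, 'p) module_scheme \<Rightarrow> ('a \<Rightarrow> 'b \<Rightarrow> 'c) set"
  where "bilinear_maps R M N P =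
    {\<beta>. (\<forall>x\<in>carrier M. \<beta> x \<in> linear_maps R N P) \<and>
        (\<forall>y\<in>carrier N. (\<lambda>x. \<beta> x y) \<in> linear_maps R M P)}"

lemma bilinear_maps_closed:
  "\<lbrakk>\<beta> \<in> bilinear_maps R M N P; x \<in> carrier M; y \<in> carrier N\<rbrakk> \<Longrightarrow> \<beta> x y \<in> carrier P"
  by (auto simp: bilinear_maps_def dest: linear_maps_closed)

lemma bilinear_maps_left:
  "\<lbrakk>\<beta> \<in> bilinear_maps R M N P; y \<in> carrier N\<rbrakk> \<Longrightarrow> (\<lambda>x. \<beta> x y) \<in> linear_maps R M P"
  by (auto simp: bilinear_maps_def)

lemma bilinear_maps_right:
  "\<lbrakk>\<beta> \<in> bilinear_maps R M N P; x \<in> carrier M\<rbrakk> \<Longrightarrow> \<beta> x \<in> linear_maps R N P"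
  by (auto simp: bilinear_maps_def)

lemma bilinear_maps_comp:
  assumes "\<beta> \<in> bilinear_maps R M N P" "f \<in> linear_maps R M' M" "g \<in> linear_maps R N' N"
  shows "(\<lambda>x y. \<beta> (f x) (g y)) \<in> bilinear_maps R M' N' P"
  using assms by (auto simp: bilinear_maps_def linear_maps_def Pi_def)

lemma bilinear_maps_post_comp:
  assumes "\<beta> \<in> bilinear_maps R M N P" "f \<in> linear_maps R P Q"
  shows "(\<lambda>x y. f (\<beta> x y)) \<in> bilinear_maps R M N Q"
  using assms by (auto simp: bilinear_maps_def linear_maps_def Pi_def)

locale module_pair = M: module R M + N: module R N
  for R :: "('r, 's) ring_scheme" and M :: "('r, 'a, 'm) module_scheme"
    and N :: "('r, 'b, 'n) module_scheme"
begin

abbreviation F where "F \<equiv> free_module R (carrier M \<times> carrier N)"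

sublocale F: module R F by (rule M.R.free_module_module)

lemma bilinearity_relations_subset: "bilinearity_relations R M N \<subseteq> carrier F"
proof -
  have g: "free_gen R (x, y) \<in> carrier F" if "x \<in> carrier M" "y \<in> carrier N" for x y
    using that by (intro M.R.free_gen_closed) auto
  show ?thesis
    unfolding bilinearity_relations_def Let_def
    by (auto intro!: F.M.minus_closed F.M.a_closed F.smult_closed g)
qed

lemma tensor_kernel_submodule: "submodule (tensor_kernel R M N) R F"
  unfolding tensor_kernel_def
  by (rule F.submodule_generated_submodule[OF bilinearity_relations_subset])

lemma tensor_module: "module R (tensor R M N)"
  unfolding tensor_def by (rule F.quotient_module_module[OF tensor_kernel_submodule])

lemma tensor_carrierE:
  assumes "X \<in> carrier (tensor R M N)"
  obtains u where "u \<in> carrier F" "X = tensor_kernel R M N +>\<^bsub>F\<^esub> u"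
  using assms by (auto simp: tensor_def F.quotient_module_carrier[OF tensor_kernel_submodule])

lemma pure_tensor_bilinear: "pure_tensor R M N \<in> bilinear_maps R M N (tensor R M N)"
proof -
  let ?K = "tensor_kernel R M N"
  let ?g = "\<lambda>x y. free_gen R (x, y)"
  interpret K: abelian_subgroup ?K F
    by (rule F.submodule_abelian_subgroup[OF tensor_kernel_submodule])
  note Q = F.quotient_module_simps[OF tensor_kernel_submodule, folded tensor_def]
  have g: "?g x y \<in> carrier F" if "x \<in> carrier M" "y \<in> carrier N" for x y
    using that by (intro M.R.free_gen_closed) auto
  \<comment> \<open>Two vectors whose difference is a relation have the same class. Each of the four
    bilinearity equations below is one of the four families of relations, read modulo
    \<open>?K\<close>.\<close>
  have eq: "?K +>\<^bsub>F\<^esub> u = ?K +>\<^bsub>F\<^esub> v"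
    if "u \<ominus>\<^bsub>F\<^esub> v \<in> bilinearity_relations R M N" "u \<in> carrier F" "v \<in> carrier F" for u v
  proof -
    have "u \<ominus>\<^bsub>F\<^esub> v \<in> ?K"
      using that(1) F.submodule_generated_incl unfolding tensor_kernel_def by blast
    then have "u \<in> ?K +>\<^bsub>F\<^esub> v"
      using K.a_rcos_module[OF that(3,2)] by (simp add: a_minus_def)
    then show ?thesis
      using F.M.a_repr_independence[OF _ that(3) K.a_subgroup] by simp
  qed
  show ?thesis
    unfolding bilinear_maps_def pure_tensor_def
  proof (intro CollectI conjI ballI linear_mapsI)
    fix x y y' assume "x \<in> carrier M" "y \<in> carrier N" "y' \<in> carrier N"
    then show "?K +>\<^bsub>F\<^esub> ?g x (y \<oplus>\<^bsub>N\<^esub> y') = (?K +>\<^bsub>F\<^esub> ?g x y) \<oplus>\<^bsub>tensor R M N\<^esub> (?K +>\<^bsub>F\<^esub> ?g x y')"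
      by (subst Q(2)) (intro g eq F.M.a_closed M.M.a_closed N.M.a_closed M.smult_closed N.smult_closed |
          (unfold bilinearity_relations_def Let_def, blast) | assumption)+
  next
    fix x y c assume "x \<in> carrier M" "y \<in> carrier N" "c \<in> carrier R"
    then show "?K +>\<^bsub>F\<^esub> ?g x (c \<odot>\<^bsub>N\<^esub> y) = c \<odot>\<^bsub>tensor R M N\<^esub> (?K +>\<^bsub>F\<^esub> ?g x y)"
      by (subst Q(3)) (intro g eq F.smult_closed M.M.a_closed N.M.a_closed M.smult_closed N.smult_closed |
          (unfold bilinearity_relations_def Let_def, blast) | assumption)+
  next
    fix x x' y assume "x \<in> carrier M" "x' \<in> carrier M" "y \<in> carrier N"
    then show "?K +>\<^bsub>F\<^esub> ?g (x \<oplus>\<^bsub>M\<^esub> x') y = (?K +>\<^bsub>F\<^esub> ?g x y) \<oplus>\<^bsub>tensor R M N\<^esub> (?K +>\<^bsub>F\<^esub> ?g x' y)"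
      by (subst Q(2)) (intro g eq F.M.a_closed M.M.a_closed N.M.a_closed M.smult_closed N.smult_closed |
          (unfold bilinearity_relations_def Let_def, blast) | assumption)+
  next
    fix x y c assume "x \<in> carrier M" "y \<in> carrier N" "c \<in> carrier R"
    then show "?K +>\<^bsub>F\<^esub> ?g (c \<odot>\<^bsub>M\<^esub> x) y = c \<odot>\<^bsub>tensor R M N\<^esub> (?K +>\<^bsub>F\<^esub> ?g x y)"
      by (subst Q(3)) (intro g eq F.smult_closed M.M.a_closed N.M.a_closed M.smult_closed N.smult_closed |
          (unfold bilinearity_relations_def Let_def, blast) | assumption)+
  qed (simp_all add: Q(1) g)
qed

text \<open>The kernel of the linear extension is a submodule, and bilinearity of \<beta> puts every
  relation into it; hence it contains the submodule that the relations generate.\<close>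

lemma bilinear_free_lift_kernel:
  assumes P: "module R P" and \<beta>: "\<beta> \<in> bilinear_maps R M N P"
    and u: "u \<in> tensor_kernel R M N"
  shows "free_lift R P (\<lambda>i. \<beta> (fst i) (snd i)) u = \<zero>\<^bsub>P\<^esub>"
proof -
  interpret P: module R P by (rule P)
  let ?b = "\<lambda>i. \<beta> (fst i) (snd i)"
  let ?\<phi> = "free_lift R P ?b"
  let ?g = "\<lambda>x y. free_gen R (x, y)"
  have b: "?b \<in> carrier M \<times> carrier N \<rightarrow> carrier P"
    using bilinear_maps_closed[OF \<beta>] by auto
  note lin = P.free_lift_linear[OF b]
  note \<phi> = linear_mapsD[OF lin]
  have g: "?g x y \<in> carrier F" "?\<phi> (?g x y) = \<beta> x y" if "x \<in> carrier M" "y \<in> carrier N" for x y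
    using that P.free_lift_gen[OF b, of "(x, y)"] by (auto intro!: M.R.free_gen_closed)
  note right = linear_mapsD[OF bilinear_maps_right[OF \<beta>]]
  note left = linear_mapsD[OF bilinear_maps_left[OF \<beta>]]
  \<comment> \<open>Every relation has the form of a difference, so it suffices to compare the
    images of its two sides, which are computed on generators.\<close>
  have zero: "v \<ominus>\<^bsub>F\<^esub> w \<in> carrier F \<and> ?\<phi> (v \<ominus>\<^bsub>F\<^esub> w) = \<zero>\<^bsub>P\<^esub>"
    if "v \<in> carrier F" "w \<in> carrier F" "?\<phi> v = ?\<phi> w" for v w
    using that linear_maps_minus[OF F.module_axioms P lin that(2)] \<phi>(1)[OF that(2)]
    by (simp add: a_minus_def \<phi>(2) P.M.r_neg)
  have "bilinearity_relations R M N \<subseteq> {v \<in> carrier F. ?\<phi> v = \<zero>\<^bsub>P\<^esub>}"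
    unfolding bilinearity_relations_def Let_def
    by (intro Un_least subsetI CollectI; elim CollectE exE conjE; hypsubst; rule zero)
      (auto simp: g \<phi> left right)
  then have "tensor_kernel R M N \<subseteq> {v \<in> carrier F. ?\<phi> v = \<zero>\<^bsub>P\<^esub>}"
    unfolding tensor_kernel_def
    by (intro F.submodule_generated_minimal kernel_submodule[OF F.module_axioms P lin])
  then show ?thesis using u by auto
qed

text \<open>Well-definedness of the lift: it may be evaluated on any representative. All later facts
  about lifts reduce through this to facts about \<open>free_lift\<close>.\<close>

lemma tensor_lift_coset:
  assumes P: "module R P" and \<beta>: "\<beta> \<in> bilinear_maps R M N P" and u: "u \<in> carrier F"
  shows "tensor_lift R P \<beta> (tensor_kernel R M N +>\<^bsub>F\<^esub> u) = free_lift R P (\<lambda>i. \<beta> (fst i) (snd i)) u"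
proof -
  interpret P: module R P by (rule P)
  interpret K: abelian_subgroup "tensor_kernel R M N" F
    by (rule F.submodule_abelian_subgroup[OF tensor_kernel_submodule])
  let ?\<phi> = "free_lift R P (\<lambda>i. \<beta> (fst i) (snd i))"
  have "(\<lambda>i. \<beta> (fst i) (snd i)) \<in> carrier M \<times> carrier N \<rightarrow> carrier P"
    using bilinear_maps_closed[OF \<beta>] by auto
  note \<phi> = linear_mapsD[OF P.free_lift_linear[OF this]]
  have "?\<phi> v = ?\<phi> u" if v: "v \<in> tensor_kernel R M N +>\<^bsub>F\<^esub> u" for v
  proof -
    obtain h where h: "h \<in> tensor_kernel R M N" "v = h \<oplus>\<^bsub>F\<^esub> u"
      using v unfolding a_r_coset_def' by blast
    then have "h \<in> carrier F" using K.a_subset by blast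
    then show ?thesis
      using h u \<phi> bilinear_free_lift_kernel[OF P \<beta> h(1)] by simp
  qed
  \<comment> \<open>Constancy together with nonemptiness makes the image a singleton, which is what
    \<open>the_elem\<close> requires.\<close>
  then have "?\<phi> ` (tensor_kernel R M N +>\<^bsub>F\<^esub> u) = {?\<phi> u}"
    using K.a_rcos_self[OF u] by (intro equalityI image_subsetI) blast+
  then show ?thesis
    by (simp add: tensor_lift_def free_lift_def)
qed

lemma tensor_lift_linear:
  assumes P: "module R P" and \<beta>: "\<beta> \<in> bilinear_maps R M N P"
  shows "tensor_lift R P \<beta> \<in> linear_maps R (tensor R M N) P"
proof -
  interpret P: module R P by (rule P)
  note Q = F.quotient_module_simps[OF tensor_kernel_submodule, folded tensor_def]
  have "(\<lambda>i. \<beta> (fst i) (snd i)) \<in> carrier M \<times> carrier N \<rightarrow> carrier P"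
    using bilinear_maps_closed[OF \<beta>] by auto
  note \<phi> = linear_mapsD[OF P.free_lift_linear[OF this]]
  show ?thesis
    by (rule linear_mapsI)
      (auto elim!: tensor_carrierE simp: tensor_lift_coset[OF P \<beta>] \<phi> Q(2,3))
qed

lemma tensor_lift_pure:
  assumes P: "module R P" and \<beta>: "\<beta> \<in> bilinear_maps R M N P"
    and "x \<in> carrier M" "y \<in> carrier N"
  shows "tensor_lift R P \<beta> (pure_tensor R M N x y) = \<beta> x y"
proof -
  interpret P: module R P by (rule P)
  have "(\<lambda>i. \<beta> (fst i) (snd i)) \<in> carrier M \<times> carrier N \<rightarrow> carrier P"
    using bilinear_maps_closed[OF \<beta>] by auto
  from P.free_lift_gen[OF this, of "(x, y)"] show ?thesis
    using assms(3,4) by (simp add: pure_tensor_def tensor_lift_coset[OF P \<beta>] M.R.free_gen_closed)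
qed

text \<open>The uniqueness half of the universal property in usable form: lifts agree once the
  bilinear maps agree on carriers, whatever they do elsewhere.\<close>

lemma tensor_lift_cong:
  assumes P: "module R P" and \<beta>: "\<beta> \<in> bilinear_maps R M N P" and \<gamma>: "\<gamma> \<in> bilinear_maps R M N P"
    and "\<And>x y. \<lbrakk>x \<in> carrier M; y \<in> carrier N\<rbrakk> \<Longrightarrow> \<beta> x y = \<gamma> x y"
    and X: "X \<in> carrier (tensor R M N)"
  shows "tensor_lift R P \<beta> X = tensor_lift R P \<gamma> X"
proof -
  interpret P: module R P by (rule P)
  have b: "(\<lambda>i. \<gamma> (fst i) (snd i)) \<in> carrier M \<times> carrier N \<rightarrow> carrier P"
    using bilinear_maps_closed[OF \<gamma>] by auto
  obtain u where u: "u \<in> carrier F" "X = tensor_kernel R M N +>\<^bsub>F\<^esub> u"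
    using X by (rule tensor_carrierE)
  have "free_lift R P (\<lambda>i. \<beta> (fst i) (snd i)) u = free_lift R P (\<lambda>i. \<gamma> (fst i) (snd i)) u"
    by (rule P.free_lift_cong[OF u(1) b]) (use assms(4) in auto)
  then show ?thesis
    using u by (simp add: tensor_lift_coset[OF P \<beta>] tensor_lift_coset[OF P \<gamma>])
qed

text \<open>A linear map can be moved inside a lift, because it commutes with the finite sum over a
  representative. This takes the place of an induction over sums of pure tensors.\<close>

lemma linear_tensor_lift:
  assumes P: "module R P" and Q: "module R Q" and f: "f \<in> linear_maps R P Q"
    and \<beta>: "\<beta> \<in> bilinear_maps R M N P" and X: "X \<in> carrier (tensor R M N)"
  shows "f (tensor_lift R P \<beta> X) = tensor_lift R Q (\<lambda>x y. f (\<beta> x y)) X"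
proof -
  have b: "(\<lambda>i. \<beta> (fst i) (snd i)) \<in> carrier M \<times> carrier N \<rightarrow> carrier P"
    using bilinear_maps_closed[OF \<beta>] by auto
  obtain u where u: "u \<in> carrier F" "X = tensor_kernel R M N +>\<^bsub>F\<^esub> u"
    using X by (rule tensor_carrierE)
  then show ?thesis
    using linear_free_lift[OF P Q f u(1) b]
    by (simp add: tensor_lift_coset[OF P \<beta>]
        tensor_lift_coset[OF Q bilinear_maps_post_comp[OF \<beta> f]])
qed

lemma bilinear_maps_add:
  assumes P: "module R P" and \<beta>: "\<beta> \<in> bilinear_maps R M N P" and \<gamma>: "\<gamma> \<in> bilinear_maps R M N P"
  shows "(\<lambda>x y. \<beta> x y \<oplus>\<^bsub>P\<^esub> \<gamma> x y) \<in> bilinear_maps R M N P"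
  using \<beta> \<gamma> by (simp add: bilinear_maps_def linear_maps_pointwise_add[OF P])

lemma tensor_lift_add:
  assumes P: "module R P" and \<beta>: "\<beta> \<in> bilinear_maps R M N P" and \<gamma>: "\<gamma> \<in> bilinear_maps R M N P"
    and X: "X \<in> carrier (tensor R M N)"
  shows "tensor_lift R P (\<lambda>x y. \<beta> x y \<oplus>\<^bsub>P\<^esub> \<gamma> x y) X = tensor_lift R P \<beta> X \<oplus>\<^bsub>P\<^esub> tensor_lift R P \<gamma> X"
proof -
  interpret P: module R P by (rule P)
  have b: "(\<lambda>i. \<beta> (fst i) (snd i)) \<in> carrier M \<times> carrier N \<rightarrow> carrier P"
    "(\<lambda>i. \<gamma> (fst i) (snd i)) \<in> carrier M \<times> carrier N \<rightarrow> carrier P"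
    using bilinear_maps_closed[OF \<beta>] bilinear_maps_closed[OF \<gamma>] by auto
  obtain u where u: "u \<in> carrier F" "X = tensor_kernel R M N +>\<^bsub>F\<^esub> u"
    using X by (rule tensor_carrierE)
  then show ?thesis
    using P.free_lift_add[OF u(1) b]
    by (simp add: tensor_lift_coset[OF P] \<beta> \<gamma> bilinear_maps_add[OF P])
qed

text \<open>Meant for a lift nested in another one: here \<open>z\<close> is the variable of the
  outer lift, and linearity in \<open>z\<close> is one half of the bilinearity that the outer lift
  demands.\<close>

lemma tensor_lift_linear_parameter:
  assumes P: "module R P" and \<beta>: "\<And>z. z \<in> carrier L \<Longrightarrow> \<beta> z \<in> bilinear_maps R M N P"
    and lin: "\<And>x y. \<lbrakk>x \<in> carrier M; y \<in> carrier N\<rbrakk> \<Longrightarrow> (\<lambda>z. \<beta> z x y) \<in> linear_maps R L P"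
    and L: "module R L" and X: "X \<in> carrier (tensor R M N)"
  shows "(\<lambda>z. tensor_lift R P (\<beta> z) X) \<in> linear_maps R L P"
proof (rule linear_mapsI)
  interpret P: module R P by (rule P)
  interpret L: module R L by (rule L)
  fix z assume z: "z \<in> carrier L"
  show "tensor_lift R P (\<beta> z) X \<in> carrier P"
    by (rule linear_maps_closed[OF tensor_lift_linear[OF P \<beta>[OF z]] X])
  {
    fix w assume w: "w \<in> carrier L"
    have zw: "z \<oplus>\<^bsub>L\<^esub> w \<in> carrier L" using z w by simp
    show "tensor_lift R P (\<beta> (z \<oplus>\<^bsub>L\<^esub> w)) X = tensor_lift R P (\<beta> z) X \<oplus>\<^bsub>P\<^esub> tensor_lift R P (\<beta> w) X"
      unfolding tensor_lift_add[OF P \<beta>[OF z] \<beta>[OF w] X, symmetric]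
      by (rule tensor_lift_cong[OF P \<beta>[OF zw] bilinear_maps_add[OF P \<beta>[OF z] \<beta>[OF w]] _ X])
        (use z w linear_maps_add[OF lin] in auto)
  }
  fix c assume c: "c \<in> carrier R"
  have cz: "c \<odot>\<^bsub>L\<^esub> z \<in> carrier L" using c z by simp
  \<comment> \<open>Over a commutative ring, scaling by \<open>c\<close> is itself linear, so
    homogeneity in the parameter is an instance of moving a linear map inside the lift.\<close>
  have scale: "(\<lambda>p. c \<odot>\<^bsub>P\<^esub> p) \<in> linear_maps R P P"
    by (rule linear_mapsI)
      (use c in \<open>simp_all add: P.smult_r_distr P.smult_assoc1[symmetric] M.R.m_comm\<close>)
  show "tensor_lift R P (\<beta> (c \<odot>\<^bsub>L\<^esub> z)) X = c \<odot>\<^bsub>P\<^esub> tensor_lift R P (\<beta> z) X"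
    unfolding linear_tensor_lift[OF P P scale \<beta>[OF z] X]
    by (rule tensor_lift_cong[OF P \<beta>[OF cz] bilinear_maps_post_comp[OF \<beta>[OF z] scale] _ X])
      (use c z linear_maps_smult[OF lin] in auto)
qed

end


section \<open>Tensor products of linear maps\<close>

lemma tensor_map_bilinear:
  assumes "module R M'" "module R N'" "f \<in> linear_maps R M M'" "g \<in> linear_maps R N N'"
  shows "(\<lambda>x y. pure_tensor R M' N' (f x) (g y)) \<in> bilinear_maps R M N (tensor R M' N')"
  by (rule bilinear_maps_comp[OF module_pair.pure_tensor_bilinear[OF module_pair.intro] assms(3,4)])
    (use assms in auto)

lemma tensor_map_linear:
  assumes "module R M" "module R N" "module R M'" "module R N'"
    and "f \<in> linear_maps R M M'" "g \<in> linear_maps R N N'"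
  shows "tensor_map R M' N' f g \<in> linear_maps R (tensor R M N) (tensor R M' N')"
  unfolding tensor_map_def
  using assms
  by (intro module_pair.tensor_lift_linear module_pair.intro module_pair.tensor_module
      tensor_map_bilinear)

lemma tensor_map_pure:
  assumes "module R M" "module R N" "module R M'" "module R N'"
    and "f \<in> linear_maps R M M'" "g \<in> linear_maps R N N'"
    and "x \<in> carrier M" "y \<in> carrier N"
  shows "tensor_map R M' N' f g (pure_tensor R M N x y) = pure_tensor R M' N' (f x) (g y)"
  unfolding tensor_map_def
  using assms
  by (intro module_pair.tensor_lift_pure module_pair.intro module_pair.tensor_module
      tensor_map_bilinear)

text \<open>Functoriality: the outer map is moved inside the lift defining the inner one, where it
  meets only pure tensors and can be evaluated.\<close>

lemma tensor_map_comp: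
  assumes M: "module R M" "module R N" and M': "module R M'" "module R N'"
    and M'': "module R M''" "module R N''"
    and f: "f \<in> linear_maps R M M'" "g \<in> linear_maps R N N'"
    and f': "f' \<in> linear_maps R M' M''" "g' \<in> linear_maps R N' N''"
    and X: "X \<in> carrier (tensor R M N)"
  shows "tensor_map R M'' N'' f' g' (tensor_map R M' N' f g X) = tensor_map R M'' N'' (f' \<circ> f) (g' \<circ> g) X"
proof -
  interpret MN: module_pair R M N by (rule module_pair.intro[OF M])
  interpret MN': module_pair R M' N' by (rule module_pair.intro[OF M'])
  interpret MN'': module_pair R M'' N'' by (rule module_pair.intro[OF M''])
  note \<beta> = tensor_map_bilinear[OF M' f]
  note lin = tensor_map_linear[OF M' M'' f']
  have "tensor_map R M'' N'' f' g' (tensor_map R M' N' f g X)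
      = tensor_lift R (tensor R M'' N'') (\<lambda>x y. tensor_map R M'' N'' f' g' (pure_tensor R M' N' (f x) (g y))) X"
    unfolding tensor_map_def[of R M' N']
    by (rule MN.linear_tensor_lift[OF MN'.tensor_module MN''.tensor_module lin \<beta> X])
  also have "\<dots> = tensor_map R M'' N'' (f' \<circ> f) (g' \<circ> g) X"
    unfolding tensor_map_def[of R M'' N'' "f' \<circ> f"]
    by (rule MN.tensor_lift_cong[OF MN''.tensor_module bilinear_maps_post_comp[OF \<beta> lin]
          tensor_map_bilinear[OF M'' linear_maps_comp linear_maps_comp] _ X])
      (use f f' in \<open>simp_all add: tensor_map_pure[OF M' M'' f'] linear_maps_closed[OF f(1)] linear_maps_closed[OF f(2)]\<close>)
  finally show ?thesis .
qed

lemma tensor_assoc_linear: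
  assumes L: "module R L" and M: "module R M" and N: "module R N"
  shows "tensor_assoc R L M N
    \<in> linear_maps R (tensor R (tensor R L M) N) (tensor R L (tensor R M N))"
proof -
  interpret LM: module_pair R L M by (rule module_pair.intro[OF L M])
  interpret MN: module_pair R M N by (rule module_pair.intro[OF M N])
  interpret LM_N: module_pair R "tensor R L M" N by (rule module_pair.intro[OF LM.tensor_module N])
  interpret L_MN: module_pair R L "tensor R M N" by (rule module_pair.intro[OF L MN.tensor_module])
  \<comment> \<open>The right factor \<open>z\<close> comes first because it is the parameter of the
    inner lift over \<open>x\<close> and \<open>y\<close>: \<open>bil\<close> serves the inner lift,
    and \<open>par\<close> gives linearity of its value in \<open>z\<close>.\<close>
  let ?\<beta> = "\<lambda>z x y. pure_tensor R L (tensor R M N) x (pure_tensor R M N y z)"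
  note out = L_MN.pure_tensor_bilinear and inn = MN.pure_tensor_bilinear
  have id: "(\<lambda>x. x) \<in> linear_maps R L L"
    using linear_maps_id by (simp add: id_def)
  have bil: "?\<beta> z \<in> bilinear_maps R L M (tensor R L (tensor R M N))" if "z \<in> carrier N" for z
    by (rule bilinear_maps_comp[OF out id bilinear_maps_left[OF inn that]])
  have par: "(\<lambda>z. ?\<beta> z x y) \<in> linear_maps R N (tensor R L (tensor R M N))"
    if "x \<in> carrier L" "y \<in> carrier M" for x y
    using linear_maps_comp[OF bilinear_maps_right[OF inn that(2)] bilinear_maps_right[OF out that(1)]]
    by (simp add: comp_def)
  show ?thesis
    unfolding tensor_assoc_def Let_def
  proof (rule LM_N.tensor_lift_linear[OF L_MN.tensor_module], unfold bilinear_maps_def, safe)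
    fix t assume t: "t \<in> carrier (tensor R L M)"
    show "(\<lambda>z. tensor_lift R (tensor R L (tensor R M N)) (?\<beta> z) t)
        \<in> linear_maps R N (tensor R L (tensor R M N))"
      by (rule LM.tensor_lift_linear_parameter[OF L_MN.tensor_module bil par N t])
  next
    fix z assume z: "z \<in> carrier N"
    show "(\<lambda>t. tensor_lift R (tensor R L (tensor R M N)) (?\<beta> z) t)
        \<in> linear_maps R (tensor R L M) (tensor R L (tensor R M N))"
      using LM.tensor_lift_linear[OF L_MN.tensor_module bil[OF z]] .
  qed
qed

lemma tensor_assoc_inv_linear:
  assumes L: "module R L" and M: "module R M" and N: "module R N"
  shows "tensor_assoc_inv R L M N
    \<in> linear_maps R (tensor R L (tensor R M N)) (tensor R (tensor R L M) N)"
proof -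
  interpret LM: module_pair R L M by (rule module_pair.intro[OF L M])
  interpret MN: module_pair R M N by (rule module_pair.intro[OF M N])
  interpret LM_N: module_pair R "tensor R L M" N by (rule module_pair.intro[OF LM.tensor_module N])
  interpret L_MN: module_pair R L "tensor R M N" by (rule module_pair.intro[OF L MN.tensor_module])
  \<comment> \<open>Here the inner lift runs over the two right factors, so the parameter is the
    left factor \<open>x\<close>.\<close>
  let ?\<beta> = "\<lambda>x y z. pure_tensor R (tensor R L M) N (pure_tensor R L M x y) z"
  note out = LM_N.pure_tensor_bilinear and inn = LM.pure_tensor_bilinear
  have id: "(\<lambda>x. x) \<in> linear_maps R N N"
    using linear_maps_id by (simp add: id_def)
  have bil: "?\<beta> x \<in> bilinear_maps R M N (tensor R (tensor R L M) N)" if "x \<in> carrier L" for x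
    by (rule bilinear_maps_comp[OF out bilinear_maps_right[OF inn that] id])
  have par: "(\<lambda>x. ?\<beta> x y z) \<in> linear_maps R L (tensor R (tensor R L M) N)"
    if "y \<in> carrier M" "z \<in> carrier N" for y z
    using linear_maps_comp[OF bilinear_maps_left[OF inn that(1)] bilinear_maps_left[OF out that(2)]]
    by (simp add: comp_def)
  show ?thesis
    unfolding tensor_assoc_inv_def Let_def
  proof (rule L_MN.tensor_lift_linear[OF LM_N.tensor_module], unfold bilinear_maps_def, safe)
    fix x assume x: "x \<in> carrier L"
    show "(\<lambda>t. tensor_lift R (tensor R (tensor R L M) N) (?\<beta> x) t)
        \<in> linear_maps R (tensor R M N) (tensor R (tensor R L M) N)"
      using MN.tensor_lift_linear[OF LM_N.tensor_module bil[OF x]] .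
  next
    fix t assume t: "t \<in> carrier (tensor R M N)"
    show "(\<lambda>x. tensor_lift R (tensor R (tensor R L M) N) (?\<beta> x) t)
        \<in> linear_maps R L (tensor R (tensor R L M) N)"
      by (rule MN.tensor_lift_linear_parameter[OF LM_N.tensor_module bil par L t])
  qed
qed


section \<open>Yau twists\<close>

context
  fixes R :: "('r, 's) ring_scheme" and A :: "('r, 'a, 'm) module_scheme"
    and \<alpha> :: "'a \<Rightarrow> 'a" and \<mu> :: "('a \<times> 'a \<Rightarrow> 'r) set \<Rightarrow> 'a"
  assumes A: "module R A"
    and \<alpha>: "\<alpha> \<in> linear_maps R A A"
    and \<mu>: "\<mu> \<in> linear_maps R (tensor R A A) A"
begin

private lemma tensor_module': "module R (tensor R A A)"
  by (rule module_pair.tensor_module[OF module_pair.intro[OF A A]])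

lemma left_term_twist:
  assumes d: "d \<in> linear_maps R A (tensor R A A)" and t: "t \<in> carrier (tensor R A A)"
  shows "left_term R A \<alpha> (\<alpha> \<circ> \<mu>) (d \<circ> \<alpha>) t
    = tensor_map R A A \<alpha> \<alpha> (left_term R A id \<mu> d (tensor_map R A A \<alpha> \<alpha> t))"
    and "left_term R A id \<mu> d t \<in> carrier (tensor R A A)"
proof -
  let ?T = "tensor R A A"
  note T = tensor_module'
  \<comment> \<open>The block shared by the twisted and untwisted terms: both sides apply it to the
    image of \<open>t\<close> under \<alpha> tensor \<alpha>, so it never has to be opened, and only
    its membership in the carrier matters for composing with the outer maps.\<close>
  define s where "s = (\<lambda>t. tensor_assoc_inv R A A A (tensor_map R A ?T id d t))"
  have s: "s t \<in> carrier (tensor R ?T A)" if "t \<in> carrier ?T" for t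
    unfolding s_def
    by (rule linear_maps_closed[OF tensor_assoc_inv_linear[OF A A A]],
        rule linear_maps_closed[OF tensor_map_linear[OF A A A T linear_maps_id d] that])
  show "left_term R A id \<mu> d t \<in> carrier (tensor R A A)"
    unfolding left_term_def
    using linear_maps_closed[OF tensor_map_linear[OF T A A A \<mu> linear_maps_id] s[OF t]]
    by (simp add: s_def)
  have t': "tensor_map R A A \<alpha> \<alpha> t \<in> carrier ?T"
    by (rule linear_maps_closed[OF tensor_map_linear[OF A A A A \<alpha> \<alpha>] t])
  show "left_term R A \<alpha> (\<alpha> \<circ> \<mu>) (d \<circ> \<alpha>) t
    = tensor_map R A A \<alpha> \<alpha> (left_term R A id \<mu> d (tensor_map R A A \<alpha> \<alpha> t))"
    using tensor_map_comp[OF A A A A A T \<alpha> \<alpha> linear_maps_id d t]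
      tensor_map_comp[OF T A A A A A \<mu> linear_maps_id \<alpha> \<alpha> s[OF t']]
    by (simp add: left_term_def s_def)
qed

lemma right_term_twist:
  assumes d: "d \<in> linear_maps R A (tensor R A A)" and t: "t \<in> carrier (tensor R A A)"
  shows "right_term R A \<alpha> (\<alpha> \<circ> \<mu>) (d \<circ> \<alpha>) t
    = tensor_map R A A \<alpha> \<alpha> (right_term R A id \<mu> d (tensor_map R A A \<alpha> \<alpha> t))"
    and "right_term R A id \<mu> d t \<in> carrier (tensor R A A)"
proof -
  let ?T = "tensor R A A"
  note T = tensor_module'
  define s where "s = (\<lambda>t. tensor_assoc R A A A (tensor_map R ?T A d id t))"
  have s: "s t \<in> carrier (tensor R A ?T)" if "t \<in> carrier ?T" for t
    unfolding s_def
    by (rule linear_maps_closed[OF tensor_assoc_linear[OF A A A]],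
        rule linear_maps_closed[OF tensor_map_linear[OF A A T A d linear_maps_id] that])
  show "right_term R A id \<mu> d t \<in> carrier (tensor R A A)"
    unfolding right_term_def
    using linear_maps_closed[OF tensor_map_linear[OF A T A A linear_maps_id \<mu>] s[OF t]]
    by (simp add: s_def)
  have t': "tensor_map R A A \<alpha> \<alpha> t \<in> carrier ?T"
    by (rule linear_maps_closed[OF tensor_map_linear[OF A A A A \<alpha> \<alpha>] t])
  show "right_term R A \<alpha> (\<alpha> \<circ> \<mu>) (d \<circ> \<alpha>) t
    = tensor_map R A A \<alpha> \<alpha> (right_term R A id \<mu> d (tensor_map R A A \<alpha> \<alpha> t))"
    using tensor_map_comp[OF A A A A T A \<alpha> \<alpha> d linear_maps_id t]
      tensor_map_comp[OF A T A A A A linear_maps_id \<mu> \<alpha> \<alpha> s[OF t']]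
    by (simp add: right_term_def s_def)
qed

text \<open>Keeping \<open>D\<close>, \<open>d\<close> and \<open>d'\<close> separate covers all
  three product rules: all equal for a derivation, \<open>(d, d')\<close> equal to
  \<open>(\<delta>\<^sub>1, D)\<close> and \<open>(D, \<delta>\<^sub>2)\<close> for a covariant
  derivation.\<close>

lemma product_rule_twist:
  assumes endo: "\<And>t. t \<in> carrier (tensor R A A) \<Longrightarrow> \<alpha> (\<mu> t) = \<mu> (tensor_map R A A \<alpha> \<alpha> t)"
    and D: "\<And>a. a \<in> carrier A \<Longrightarrow> tensor_map R A A \<alpha> \<alpha> (D a) = D (\<alpha> a)"
    and rule: "\<And>t. t \<in> carrier (tensor R A A) \<Longrightarrow>
      D (\<mu> t) = left_term R A id \<mu> d t \<oplus>\<^bsub>tensor R A A\<^esub> right_term R A id \<mu> d' t"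
    and d: "d \<in> linear_maps R A (tensor R A A)" and d': "d' \<in> linear_maps R A (tensor R A A)"
    and t: "t \<in> carrier (tensor R A A)"
  shows "(D \<circ> \<alpha>) ((\<alpha> \<circ> \<mu>) t) = left_term R A \<alpha> (\<alpha> \<circ> \<mu>) (d \<circ> \<alpha>) t
    \<oplus>\<^bsub>tensor R A A\<^esub> right_term R A \<alpha> (\<alpha> \<circ> \<mu>) (d' \<circ> \<alpha>) t"
proof -
  let ?t = "tensor_map R A A \<alpha> \<alpha> t"
  note lin = tensor_map_linear[OF A A A A \<alpha> \<alpha>]
  have t': "?t \<in> carrier (tensor R A A)"
    by (rule linear_maps_closed[OF lin t])
  \<comment> \<open>Of the two factors \<alpha> standing between \<open>D\<close> and \<mu>, one is
    absorbed into the argument of \<mu>; the next step pulls the other out in front of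
    \<open>D\<close>. This yields exactly the two outer factors of the twisted terms.\<close>
  have "(D \<circ> \<alpha>) ((\<alpha> \<circ> \<mu>) t) = D (\<alpha> (\<mu> ?t))"
    using endo[OF t] by simp
  also have "\<dots> = tensor_map R A A \<alpha> \<alpha> (D (\<mu> ?t))"
    using D[OF linear_maps_closed[OF \<mu> t']] by simp
  also have "\<dots> = left_term R A \<alpha> (\<alpha> \<circ> \<mu>) (d \<circ> \<alpha>) t
    \<oplus>\<^bsub>tensor R A A\<^esub> right_term R A \<alpha> (\<alpha> \<circ> \<mu>) (d' \<circ> \<alpha>) t"
    unfolding rule[OF t'] left_term_twist(1)[OF d t] right_term_twist(1)[OF d' t]
    by (rule linear_maps_add[OF lin left_term_twist(2)[OF d t'] right_term_twist(2)[OF d' t']])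
  finally show ?thesis .
qed

end


theorem proposition5p4:
  fixes R :: "('r, 's) ring_scheme" and A :: "('r, 'a, 'm) module_scheme"
    and \<mu> :: "('a \<times> 'a \<Rightarrow> 'r) set \<Rightarrow> 'a"
    and \<Delta> \<delta>\<^sub>1 \<delta>\<^sub>2 :: "'a \<Rightarrow> ('a \<times> 'a \<Rightarrow> 'r) set"
    and \<alpha> :: "'a \<Rightarrow> 'a"
  assumes "covariant_bialgebra R A \<mu> \<Delta> \<delta>\<^sub>1 \<delta>\<^sub>2"
    and "covariant_bialgebra_endomorphism R A \<mu> \<Delta> \<delta>\<^sub>1 \<delta>\<^sub>2 \<alpha>"
  shows "covariant_hom_bialgebra R A \<alpha> (\<alpha> \<circ> \<mu>) (\<Delta> \<circ> \<alpha>) (\<delta>\<^sub>1 \<circ> \<alpha>) (\<delta>\<^sub>2 \<circ> \<alpha>)"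
proof -
  let ?T = "tensor R A A"
  note bialgebra = assms(1)[unfolded covariant_bialgebra_def covariant_hom_bialgebra_def]
  interpret alg: hom_associative_algebra R A id \<mu> using bialgebra by blast
  interpret coalg: hom_coassociative_coalgebra R A id \<Delta> using bialgebra by blast
  interpret cov: hom_covariant_derivation R A id \<mu> \<delta>\<^sub>1 \<delta>\<^sub>2 \<Delta> using bialgebra by blast
  have \<alpha>: "\<alpha> \<in> linear_maps R A A"
    and endo_\<mu>: "\<And>t. t \<in> carrier ?T \<Longrightarrow> \<alpha> (\<mu> t) = \<mu> (tensor_map R A A \<alpha> \<alpha> t)"
    and endo_\<Delta>: "\<And>a. a \<in> carrier A \<Longrightarrow> tensor_map R A A \<alpha> \<alpha> (\<Delta> a) = \<Delta> (\<alpha> a)"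
    and endo_\<delta>\<^sub>1: "\<And>a. a \<in> carrier A \<Longrightarrow> tensor_map R A A \<alpha> \<alpha> (\<delta>\<^sub>1 a) = \<delta>\<^sub>1 (\<alpha> a)"
    and endo_\<delta>\<^sub>2: "\<And>a. a \<in> carrier A \<Longrightarrow> tensor_map R A A \<alpha> \<alpha> (\<delta>\<^sub>2 a) = \<delta>\<^sub>2 (\<alpha> a)"
    using assms(2) by (auto simp: covariant_bialgebra_endomorphism_def)
  have A: "module R A" by (rule alg.module_axioms)
  have R: "field R" by (rule alg.R.field_axioms)
  interpret AA: module_pair R A A by (rule module_pair.intro[OF A A])
  have T: "module R ?T" by (rule AA.tensor_module)
  note \<mu> = alg.mult_linear
  note closed = linear_maps_closed[OF \<alpha>] linear_maps_closed[OF \<mu>]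
    bilinear_maps_closed[OF AA.pure_tensor_bilinear]
  have \<alpha>_\<mu>: "\<alpha> (\<mu> (pure_tensor R A A a b)) = \<mu> (pure_tensor R A A (\<alpha> a) (\<alpha> b))"
    if "a \<in> carrier A" "b \<in> carrier A" for a b
    using that endo_\<mu> closed tensor_map_pure[OF A A A A \<alpha> \<alpha>] by simp
  \<comment> \<open>With \<open>\<alpha>_\<mu>\<close> read backwards, both sides of
    Hom-associativity become \<alpha> applied twice to the two bracketings of \<open>a\<close>,
    \<open>b\<close>, \<open>c\<close>, which agree by ordinary associativity.\<close>
  have algebra: "hom_associative_algebra R A \<alpha> (\<alpha> \<circ> \<mu>)"
    by (intro hom_associative_algebra.intro hom_associative_algebra_axioms.intro R A \<alpha>
        linear_maps_comp[OF \<mu> \<alpha>])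
      (use alg.hom_associative in \<open>simp_all add: \<alpha>_\<mu>[symmetric] closed\<close>)
  have coalgebra: "hom_coassociative_coalgebra R A \<alpha> (\<Delta> \<circ> \<alpha>)"
  proof (intro hom_coassociative_coalgebra.intro hom_coassociative_coalgebra_axioms.intro R A \<alpha>
        linear_maps_comp[OF \<alpha> coalg.comult_linear])
    fix a assume a: "a \<in> carrier A"
    show "tensor_map R A A \<alpha> \<alpha> ((\<Delta> \<circ> \<alpha>) a) = (\<Delta> \<circ> \<alpha>) (\<alpha> a)"
      using endo_\<Delta> a closed(1) by simp
    have \<Delta>a: "\<Delta> (\<alpha> a) \<in> carrier ?T"
      using linear_maps_closed[OF coalg.comult_linear] a closed(1) by simp
    \<comment> \<open>The twist inside the tensor map is passed to \<Delta> as a further \<alpha> on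
      its argument. Both sides thus become the two sides of ordinary coassociativity at \<alpha>
      applied twice to \<open>a\<close>.\<close>
    have "tensor_map R ?T A (\<Delta> \<circ> \<alpha>) \<alpha> (\<Delta> (\<alpha> a)) = tensor_map R ?T A \<Delta> id (\<Delta> (\<alpha> (\<alpha> a)))"
      using tensor_map_comp[OF A A A A T A \<alpha> \<alpha> coalg.comult_linear linear_maps_id \<Delta>a] endo_\<Delta> a closed(1)
      by simp
    moreover have "tensor_map R A ?T \<alpha> (\<Delta> \<circ> \<alpha>) (\<Delta> (\<alpha> a)) = tensor_map R A ?T id \<Delta> (\<Delta> (\<alpha> (\<alpha> a)))"
      using tensor_map_comp[OF A A A A A T \<alpha> \<alpha> linear_maps_id coalg.comult_linear \<Delta>a] endo_\<Delta> a closed(1)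
      by simp
    ultimately show "tensor_assoc R A A A (tensor_map R ?T A (\<Delta> \<circ> \<alpha>) \<alpha> ((\<Delta> \<circ> \<alpha>) a))
        = tensor_map R A ?T \<alpha> (\<Delta> \<circ> \<alpha>) ((\<Delta> \<circ> \<alpha>) a)"
      using coalg.hom_coassociative a closed(1) by simp
  qed
  note product_rule = product_rule_twist[OF A \<alpha> \<mu> endo_\<mu>]
  have deriv: "hom_derivation R A \<alpha> (\<alpha> \<circ> \<mu>) (d \<circ> \<alpha>)"
    if "hom_derivation R A id \<mu> d"
      and endo: "\<And>a. a \<in> carrier A \<Longrightarrow> tensor_map R A A \<alpha> \<alpha> (d a) = d (\<alpha> a)" for d
  proof -
    interpret d: hom_derivation R A id \<mu> d by fact
    show ?thesis
      by (intro hom_derivation.intro hom_derivation_axioms.intro algebra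
          linear_maps_comp[OF \<alpha> d.deriv_linear]
          product_rule[OF _ endo d.deriv_mult d.deriv_linear d.deriv_linear])
        (simp_all add: endo closed(1))
  qed
  have deriv\<^sub>1: "hom_derivation R A \<alpha> (\<alpha> \<circ> \<mu>) (\<delta>\<^sub>1 \<circ> \<alpha>)"
    by (rule deriv[OF cov.d1.hom_derivation_axioms endo_\<delta>\<^sub>1])
  have deriv\<^sub>2: "hom_derivation R A \<alpha> (\<alpha> \<circ> \<mu>) (\<delta>\<^sub>2 \<circ> \<alpha>)"
    by (rule deriv[OF cov.d2.hom_derivation_axioms endo_\<delta>\<^sub>2])
  \<comment> \<open>The two product rules differ only in which slot \<Delta> fills: the right term
    in the first, beside \<open>\<delta>\<^sub>1\<close>, and the left term in the second, beside
    \<open>\<delta>\<^sub>2\<close>.\<close>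
  have "hom_covariant_derivation R A \<alpha> (\<alpha> \<circ> \<mu>) (\<delta>\<^sub>1 \<circ> \<alpha>) (\<delta>\<^sub>2 \<circ> \<alpha>) (\<Delta> \<circ> \<alpha>)"
    by (intro hom_covariant_derivation.intro hom_covariant_derivation_axioms.intro deriv\<^sub>1 deriv\<^sub>2
        linear_maps_comp[OF \<alpha> cov.covariant_linear]
        product_rule[OF _ endo_\<Delta> cov.covariant_mult1 cov.d1.deriv_linear cov.covariant_linear]
        product_rule[OF _ endo_\<Delta> cov.covariant_mult2 cov.covariant_linear cov.d2.deriv_linear])
      (simp_all add: endo_\<Delta> closed(1))
  with algebra coalgebra deriv\<^sub>1 deriv\<^sub>2 show ?thesis
    by (simp add: covariant_hom_bialgebra_def)
qed

end
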